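(* Let $n\ge2$ and $0\le k\le n-1$. The following numbers are all equal: (0) the number of NBC bases of activity $k$ of the Shi gain graph $S_n=K_n^{[0,1]}$; (1) the number of rooted labeled trees on $[n]$ in which vertex $n$ has exactly $k$ children (i.e., exactly $k$ edges of the form $(n,i)$); (2) the number of rooted labeled trees on $[n]$ having exactly $k$ edges of the form $(i+1,i)$ (edges whose parent is $i+1$ and whose child is $i$); (3) $\binom{n-1}{k}(n-1)^{n-1-k}$.
   Context: $K_n^{[0,1]}$ is the gain graph on $[n]$ with, for each $1\le i<j\le n$, two edges from $i$ to $j$ with gains $0$ and $1$ (hyperplanes $x_j-x_i=0$ and $x_j-x_i=1$); traversed backwards an edge of gain $g$ has gain $-g$. A circle is balanced if its gain sum in a fixed direction is $0$. Fix a linear order on the edges; a broken circuit is a balanced circle minus its smallest edge; an NBC set is an edge set forming a forest of the underlying multigraph (no circles, no two parallel edges) containing no broken circuit; an NBC basis is an NBC set which is a spanning tree. For an NBC basis $B$, $e\in B$ is active if $e$ is the smallest edge among all edges $f$ such that $(B\setminus\{e\})\cup\{f\}$ is a spanning tree; the activity of $B$ is the number of its active edges (these counts do not depend on the order). A rooted labeled tree on $[n]$ is a spanning tree on vertex set $[n]$ with a distinguished root, edges directed from parent to child. *)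

theory Defs
  imports Main
begin

text \<open>Edges of the gain graph K_n^[0,1]: a triple (i, j, g) is the edge from i to j
  with gain g (hyperplane x_j - x_i = g), where 1 <= i < j <= n and g in {0,1}.\<close>

type_synonym gedge = "nat \<times> nat \<times> int"

definition shi_edges :: "nat \<Rightarrow> gedge set" where
  "shi_edges n = {(i, j, g). 1 \<le> i \<and> i < j \<and> j \<le> n \<and> (g = 0 \<or> g = 1)}"

text \<open>Edge e joins u to v (in this direction of traversal).\<close>
definition joins :: "gedge \<Rightarrow> nat \<Rightarrow> nat \<Rightarrow> bool" where
  "joins e u v \<longleftrightarrow> (fst e = u \<and> fst (snd e) = v) \<or> (fst e = v \<and> fst (snd e) = u)"

text \<open>Gain of edge e traversed from u to v: g forwards, -g backwards.\<close>
definition gain_dir :: "gedge \<Rightarrow> nat \<Rightarrow> nat \<Rightarrow> int" where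
  "gain_dir e u v = (if fst e = u \<and> fst (snd e) = v then snd (snd e) else - snd (snd e))"

text \<open>A circle, given by a cyclic sequence of distinct vertices vs and distinct edges es
  (es!t joins vs!t to vs!(t+1 mod m)), m >= 2 (m = 2: two parallel edges).\<close>
definition circle_walk :: "gedge set \<Rightarrow> nat list \<Rightarrow> gedge list \<Rightarrow> bool" where
  "circle_walk C vs es \<longleftrightarrow>
     length vs \<ge> 2 \<and> length es = length vs \<and> distinct vs \<and> distinct es \<and> set es = C \<and>
     (\<forall>t < length vs. joins (es ! t) (vs ! t) (vs ! ((t + 1) mod length vs)))"

definition is_circle :: "gedge set \<Rightarrow> bool" where
  "is_circle C \<longleftrightarrow> (\<exists>vs es. circle_walk C vs es)"

text \<open>Balanced: the gain sum along the circle in a fixed direction is 0.\<close>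
definition balanced_circle :: "gedge set \<Rightarrow> bool" where
  "balanced_circle C \<longleftrightarrow> (\<exists>vs es. circle_walk C vs es \<and>
     (\<Sum>t < length vs. gain_dir (es ! t) (vs ! t) (vs ! ((t + 1) mod length vs))) = 0)"

text \<open>Smallest element of S w.r.t. the linear order R (a reflexive relation).\<close>
definition is_min_in :: "gedge rel \<Rightarrow> gedge set \<Rightarrow> gedge \<Rightarrow> bool" where
  "is_min_in R S e \<longleftrightarrow> e \<in> S \<and> (\<forall>f \<in> S. (e, f) \<in> R)"

definition broken_circuit :: "nat \<Rightarrow> gedge rel \<Rightarrow> gedge set \<Rightarrow> bool" where
  "broken_circuit n R D \<longleftrightarrow> (\<exists>C e. C \<subseteq> shi_edges n \<and> balanced_circle C \<and>
      is_min_in R C e \<and> D = C - {e})"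

text \<open>Forest of the underlying multigraph: contains no circle (this also excludes
  two parallel edges, which form a circle of length 2).\<close>
definition is_forest :: "gedge set \<Rightarrow> bool" where
  "is_forest B \<longleftrightarrow> (\<forall>C \<subseteq> B. \<not> is_circle C)"

definition connected_on :: "nat \<Rightarrow> gedge set \<Rightarrow> bool" where
  "connected_on n B \<longleftrightarrow>
     (\<forall>u \<in> {1..n}. \<forall>v \<in> {1..n}. (u, v) \<in> {(a, b). \<exists>e \<in> B. joins e a b}\<^sup>*)"

definition spanning_tree :: "nat \<Rightarrow> gedge set \<Rightarrow> bool" where
  "spanning_tree n B \<longleftrightarrow> B \<subseteq> shi_edges n \<and> is_forest B \<and> connected_on n B"

definition nbc_set :: "nat \<Rightarrow> gedge rel \<Rightarrow> gedge set \<Rightarrow> bool" where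
  "nbc_set n R B \<longleftrightarrow> B \<subseteq> shi_edges n \<and> is_forest B \<and>
     (\<forall>D. broken_circuit n R D \<longrightarrow> \<not> D \<subseteq> B)"

definition nbc_basis :: "nat \<Rightarrow> gedge rel \<Rightarrow> gedge set \<Rightarrow> bool" where
  "nbc_basis n R B \<longleftrightarrow> nbc_set n R B \<and> spanning_tree n B"

definition active_edge :: "nat \<Rightarrow> gedge rel \<Rightarrow> gedge set \<Rightarrow> gedge \<Rightarrow> bool" where
  "active_edge n R B e \<longleftrightarrow> e \<in> B \<and>
     is_min_in R {f \<in> shi_edges n. spanning_tree n ((B - {e}) \<union> {f})} e"

definition activity :: "nat \<Rightarrow> gedge rel \<Rightarrow> gedge set \<Rightarrow> nat" where
  "activity n R B = card {e \<in> B. active_edge n R B e}"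

text \<open>Rooted labeled tree on [n]: root r and set D of directed edges (parent, child);
  the root has no parent, every other vertex has exactly one parent, and every
  vertex is reached from the root (i.e. a spanning tree oriented away from r).\<close>
definition rooted_tree :: "nat \<Rightarrow> nat \<Rightarrow> (nat \<times> nat) set \<Rightarrow> bool" where
  "rooted_tree n r D \<longleftrightarrow> r \<in> {1..n} \<and> D \<subseteq> {1..n} \<times> {1..n} \<and>
     (\<forall>v \<in> {1..n}. (r, v) \<in> D\<^sup>*) \<and>
     (\<forall>v \<in> {1..n}. card {u. (u, v) \<in> D} = (if v = r then 0 else 1))"

end

theory Submission
  imports Defs "HOL-Computational_Algebra.Polynomial" "HOL-Library.FuncSet"
begin

text \<open>All three families carry a statistic \<open>s\<close> with \<open>\<Sum>x. (t + 1) ^ s x = (t + n) ^ (n - 1)\<close>; comparing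
  coefficients of powers of \<open>t + 1\<close> gives the closed form.

  For rooted trees, both \<open>{(n, i)}\<close> and \<open>{(i + 1, i)}\<close> are edge sets of rooted trees \<open>P\<close>. By Pitman's double
  count, a rooted forest with \<open>j\<close> edges is contained in \<open>n ^ (n - 1 - j)\<close> rooted trees, so expanding
  \<open>(t + 1) ^ card (D \<inter> P)\<close> over the subsets of \<open>D \<inter> P\<close> gives the generating function.

  For NBC bases, each NBC set \<open>S\<close> lies in exactly one interval between an NBC basis \<open>B\<close> without its
  active edges and \<open>B\<close> itself, where \<open>B\<close> is the greedy completion of \<open>S\<close>; hence the sum
  is \<open>\<Sum>S. t ^ (n - 1 - card S)\<close> over NBC sets. At \<open>t = - q\<close> with \<open>q > n\<close> Whitney's broken circuit argument
  identifies this, up to the factor \<open>(-1) ^ (n - 1) * q\<close>, with the number of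
  points of \<open>(\<int>/q)\<^sup>n\<close> avoiding all hyperplanes, which is \<open>q * (q - n) ^ (n - 1)\<close>.\<close>

section \<open>Generating functions\<close>

lemma sum_Pow_power:
  fixes s t :: "'a::comm_ring_1"
  assumes "finite P"
  shows "(\<Sum>A\<in>Pow P. t ^ card A * s ^ (card P - card A)) = (t + s) ^ card P"
proof -
  have "(t + s) ^ card P = (\<Prod>i\<in>P. t + s)"
    by simp
  also have "\<dots> = (\<Sum>A\<in>Pow P. (\<Prod>i\<in>A. t) * (\<Prod>i\<in>P - A. s))"
    using assms by (rule prod_add)
  also have "\<dots> = (\<Sum>A\<in>Pow P. t ^ card A * s ^ (card P - card A))"
    using assms by (intro sum.cong) (auto simp: card_Diff_subset finite_subset)
  finally show ?thesis ..
qed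

text \<open>With \<open>y = 1 - q\<close> the hypothesis says that the polynomials \<Sum> y^(s x)
  and (y + n - 1)^(n - 1) agree at every integer y < 1 - n. Infinitely many common values force
  equal coefficients.\<close>

lemma card_statistic_eq_binomial:
  fixes s :: "'a \<Rightarrow> nat"
  assumes "finite X" and "n \<ge> 1" and "k \<le> n - 1"
    and gf: "\<And>q::int. q > int n \<Longrightarrow> (\<Sum>x\<in>X. (1 - q) ^ s x) = (int n - q) ^ (n - 1)"
  shows "card {x \<in> X. s x = k} = (n - 1 choose k) * (n - 1) ^ (n - 1 - k)"
proof -
  define p :: "int poly" where
    "p = (\<Sum>x\<in>X. monom 1 (s x)) - [:int (n - 1), 1:] ^ (n - 1)"
  have "poly p y = 0" if "y < 1 - int n" for y
    using gf[of "1 - y"] that \<open>n \<ge> 1\<close>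
    by (simp add: p_def poly_sum poly_monom of_nat_diff algebra_simps)
  then have "{..<1 - int n} \<subseteq> {y. poly p y = 0}"
    by auto
  moreover have "infinite {..<1 - int n}"
    by (rule infinite_Iio)
  ultimately have "p = 0"
    using poly_roots_finite finite_subset by blast
  then have "coeff (\<Sum>x\<in>X. monom (1::int) (s x)) k = coeff ([:int (n - 1), 1:] ^ (n - 1)) k"
    by (simp add: p_def)
  moreover have "coeff (\<Sum>x\<in>X. monom (1::int) (s x)) k = int (card {x \<in> X. s x = k})"
    using \<open>finite X\<close> by (simp add: coeff_sum sum.If_cases Int_def)
  ultimately have "int (card {x \<in> X. s x = k}) = int ((n - 1 choose k) * (n - 1) ^ (n - 1 - k))"
    using \<open>k \<le> n - 1\<close> by (simp add: coeff_linear_poly_power)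
  then show ?thesis
    by (simp only: of_nat_eq_iff)
qed

section \<open>Rooted trees\<close>

text \<open>Edges point from parent to child, so single-valuedness of the converse gives each vertex
  at most one parent. No root is recorded, which keeps the notion closed under subsets.\<close>

definition rooted_forest :: "nat \<Rightarrow> (nat \<times> nat) set \<Rightarrow> bool" where
  "rooted_forest n D \<longleftrightarrow> D \<subseteq> {1..n} \<times> {1..n} \<and> acyclic D \<and> single_valued (D\<inverse>)"

definition forest_roots :: "nat \<Rightarrow> (nat \<times> nat) set \<Rightarrow> nat set" where
  "forest_roots n D = {v \<in> {1..n}. \<forall>u. (u, v) \<notin> D}"

lemma rooted_forest_finite: "rooted_forest n D \<Longrightarrow> finite D"
  unfolding rooted_forest_def by (metis finite_SigmaI finite_atLeastAtMost finite_subset)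

lemma rooted_forest_subset: "rooted_forest n D \<Longrightarrow> A \<subseteq> D \<Longrightarrow> rooted_forest n A"
  unfolding rooted_forest_def
  by (meson acyclic_subset converse_mono order_trans single_valued_subset)

text \<open>Distinct edges have distinct children, and the vertices that are not children are the
  roots.\<close>

lemma card_forest_roots:
  assumes "rooted_forest n D"
  shows "card (forest_roots n D) = n - card D" "card D \<le> n"
proof -
  have "inj_on snd D"
    using assms by (auto simp: rooted_forest_def single_valued_def inj_on_def)
  then have "card (snd ` D) = card D"
    by (rule card_image)
  moreover have "snd ` D \<subseteq> {1..n}"
    using assms by (auto simp: rooted_forest_def)
  moreover have "forest_roots n D = {1..n} - snd ` D"
    by (force simp: forest_roots_def)
  ultimately show "card (forest_roots n D) = n - card D" "card D \<le> n"
    using card_mono[of "{1..n}" "snd ` D"] by (auto simp: card_Diff_subset finite_subset)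
qed

text \<open>Existence climbs from \<open>v\<close> to parents by well-founded induction. The
  ancestors of \<open>v\<close> form a chain because parents are unique, and a root has no proper
  ancestor, so two roots above \<open>v\<close> coincide.\<close>

lemma ex1_forest_root:
  assumes D: "rooted_forest n D" and v: "v \<in> {1..n}"
  shows "\<exists>!w. w \<in> forest_roots n D \<and> (w, v) \<in> D\<^sup>*"
proof -
  have "wf D"
    using D rooted_forest_finite finite_acyclic_wf unfolding rooted_forest_def by blast
  then have "v \<in> {1..n} \<longrightarrow> (\<exists>w. w \<in> forest_roots n D \<and> (w, v) \<in> D\<^sup>*)"
  proof (induction v rule: wf_induct_rule)
    case (less v)
    show ?case
    proof (cases "v \<in> forest_roots n D")
      case False
      show ?thesis
      proof
        assume "v \<in> {1..n}"
        with False obtain u where u: "(u, v) \<in> D"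
          by (auto simp: forest_roots_def)
        with D have "u \<in> {1..n}"
          by (auto simp: rooted_forest_def)
        with less u show "\<exists>w. w \<in> forest_roots n D \<and> (w, v) \<in> D\<^sup>*"
          by (meson rtrancl.rtrancl_into_rtrancl)
      qed
    qed auto
  qed
  moreover have "w = w'"
    if w: "w \<in> forest_roots n D" "w' \<in> forest_roots n D" and r: "(w, v) \<in> D\<^sup>*" "(w', v) \<in> D\<^sup>*" for w w'
  proof -
    have "(v, w) \<in> (D\<inverse>)\<^sup>*" "(v, w') \<in> (D\<inverse>)\<^sup>*"
      using r by (simp_all add: rtrancl_converse)
    then have "(w, w') \<in> (D\<inverse>)\<^sup>* \<or> (w', w) \<in> (D\<inverse>)\<^sup>*"
      using D single_valued_confluent unfolding rooted_forest_def by metis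
    then have "(w, w') \<in> D\<^sup>* \<or> (w', w) \<in> D\<^sup>*"
      by (auto simp: rtrancl_converse)
    then show "w = w'"
      using w by (auto simp: forest_roots_def elim: rtranclE)
  qed
  ultimately show ?thesis
    using v by blast
qed

lemma card_rooted_forest_less:
  assumes "rooted_forest n D" "n \<ge> 1"
  shows "card D \<le> n - 1"
proof -
  have "forest_roots n D \<noteq> {}"
    using ex1_forest_root[OF assms(1), of 1] assms(2) by auto
  moreover have "finite (forest_roots n D)"
    by (simp add: forest_roots_def)
  ultimately have "card (forest_roots n D) > 0"
    by (simp add: card_gt_0_iff)
  then show ?thesis
    using card_forest_roots[OF assms(1)] by simp
qed

text \<open>An edge into \<open>w\<close> keeps parents unique when \<open>w\<close> is still
  parentless, and it closes a cycle exactly when \<open>v\<close> already lies in the tree below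
  \<open>w\<close>.\<close>

lemma rooted_forest_insert_iff:
  assumes "rooted_forest n F"
  shows "(v, w) \<notin> F \<and> rooted_forest n (insert (v, w) F) \<longleftrightarrow>
    v \<in> {1..n} \<and> w \<in> forest_roots n F \<and> (w, v) \<notin> F\<^sup>*"
proof
  assume L: "(v, w) \<notin> F \<and> rooted_forest n (insert (v, w) F)"
  then have "(u, w) \<notin> F" for u
    unfolding rooted_forest_def single_valued_def by (metis converse_iff insert_iff)
  then show "v \<in> {1..n} \<and> w \<in> forest_roots n F \<and> (w, v) \<notin> F\<^sup>*"
    using L by (simp add: rooted_forest_def forest_roots_def acyclic_insert)
next
  assume R: "v \<in> {1..n} \<and> w \<in> forest_roots n F \<and> (w, v) \<notin> F\<^sup>*"
  then have w: "(u, w) \<notin> F" for u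
    by (simp add: forest_roots_def)
  have "single_valued ((insert (v, w) F)\<inverse>)"
  proof (rule single_valuedI)
    fix x y z assume "(x, y) \<in> (insert (v, w) F)\<inverse>" "(x, z) \<in> (insert (v, w) F)\<inverse>"
    then show "y = z"
      using w assms unfolding rooted_forest_def single_valued_def by blast
  qed
  then show "(v, w) \<notin> F \<and> rooted_forest n (insert (v, w) F)"
    using R w assms by (simp add: rooted_forest_def forest_roots_def acyclic_insert)
qed

text \<open>Any vertex \<open>v\<close> can serve as parent, and it can adopt every root except that
  of its own tree.\<close>

lemma card_rooted_forest_extensions:
  assumes F: "rooted_forest n F" and "n \<ge> 1"
  shows "card {e. e \<notin> F \<and> rooted_forest n (insert e F)} = n * (n - 1 - card F)"
proof -
  have "{e. e \<notin> F \<and> rooted_forest n (insert e F)} =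
      (SIGMA v:{1..n}. {w \<in> forest_roots n F. (w, v) \<notin> F\<^sup>*})"
    using rooted_forest_insert_iff[OF F] by (intro set_eqI) (clarsimp simp del: atLeastAtMost_iff)
  moreover have "card {w \<in> forest_roots n F. (w, v) \<notin> F\<^sup>*} = n - 1 - card F" if v: "v \<in> {1..n}" for v
  proof -
    obtain r where r: "r \<in> forest_roots n F" "(r, v) \<in> F\<^sup>*"
      and uniq: "\<And>w. w \<in> forest_roots n F \<Longrightarrow> (w, v) \<in> F\<^sup>* \<Longrightarrow> w = r"
      using ex1_forest_root[OF F v] by blast
    then have "{w \<in> forest_roots n F. (w, v) \<notin> F\<^sup>*} = forest_roots n F - {r}"
      by blast
    then show ?thesis
      using r card_forest_roots[OF F] by simp
  qed
  ultimately show ?thesis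
    by (simp add: forest_roots_def)
qed

text \<open>Pitman's double count: a tree containing \<open>F\<close> has \<open>d = n - 1 - card F\<close> further edges, while
  \<open>F\<close> can be extended by one edge in \<open>n * d\<close> ways.\<close>
lemma card_rooted_trees_containing:
  assumes "rooted_forest n F" and n: "n \<ge> 1"
  shows "card {D. rooted_forest n D \<and> card D = n - 1 \<and> F \<subseteq> D} = n ^ (n - 1 - card F)"
  using assms(1)
proof (induction "n - 1 - card F" arbitrary: F)
  case 0
  then have "card F = n - 1"
    using card_rooted_forest_less[OF _ n, of F] by simp
  moreover from this have "D = F" if "rooted_forest n D" "card D = n - 1" "F \<subseteq> D" for D
    using that card_subset_eq[OF rooted_forest_finite, of n D F] by simp
  ultimately have "{D. rooted_forest n D \<and> card D = n - 1 \<and> F \<subseteq> D} = {F}"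
    using 0 by blast
  then show ?case
    using 0 by simp
next
  case (Suc d)
  define T where "T = (\<lambda>F. {D. rooted_forest n D \<and> card D = n - 1 \<and> F \<subseteq> D})"
  define Ext where "Ext = {e. e \<notin> F \<and> rooted_forest n (insert e F)}"
  have finF: "finite F"
    using Suc.prems by (rule rooted_forest_finite)
  have finT: "finite (T F)"
    by (rule finite_subset[of _ "Pow ({1..n} \<times> {1..n})"]) (auto simp: T_def rooted_forest_def)
  have cardE: "card Ext = n * Suc d"
    unfolding Ext_def using card_rooted_forest_extensions[OF Suc.prems n] Suc.hyps(2) by simp
  then have finE: "finite Ext"
    using n by (intro card_ge_0_finite) simp
  have "card {D \<in> T F. e \<in> D} = n ^ d" if e: "e \<in> Ext" for e
  proof -
    have "d = n - 1 - card (insert e F)"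
      using e Suc.hyps(2) finF by (simp add: Ext_def)
    then have "card (T (insert e F)) = n ^ d"
      using Suc.hyps(1)[of "insert e F"] e by (simp add: T_def Ext_def)
    moreover have "T (insert e F) = {D \<in> T F. e \<in> D}"
      by (auto simp: T_def)
    ultimately show ?thesis
      by simp
  qed
  then have "(\<Sum>D\<in>T F. card {e \<in> Ext. e \<in> D}) = n ^ d * card Ext"
    by (intro sum_multicount[OF finT finE]) blast
  moreover have "card {e \<in> Ext. e \<in> D} = Suc d" if D: "D \<in> T F" for D
  proof -
    \<comment> \<open>Subsets of rooted forests are rooted forests, so each edge of \<open>D\<close>
      outside \<open>F\<close> is an admissible extension.\<close>
    have "{e \<in> Ext. e \<in> D} = D - F"
      using D by (auto simp: T_def Ext_def intro: rooted_forest_subset)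
    then show ?thesis
      using D finF Suc.hyps(2) by (simp add: T_def card_Diff_subset)
  qed
  ultimately have "card (T F) * Suc d = n ^ d * (n * Suc d)"
    using cardE by simp
  then have "card (T F) = n ^ Suc d"
    by (metis mult.assoc mult.commute mult_right_cancel nat.simps(3) power_Suc)
  then show ?case
    using Suc.hyps(2) by (simp add: T_def)
qed

section \<open>Rooted trees as rooted forests with \<open>n - 1\<close> edges\<close>

lemma rooted_tree_unique_root:
  assumes "rooted_tree n r D" "rooted_tree n r' D"
  shows "r = r'"
  using assms unfolding rooted_tree_def by (metis zero_neq_one)

lemma rooted_tree_imp_forest:
  assumes "rooted_tree n r D"
  shows "rooted_forest n D" "forest_roots n D = {r}"
proof -
  have sub: "D \<subseteq> {1..n} \<times> {1..n}" and r: "r \<in> {1..n}"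
    and reach: "\<And>v. v \<in> {1..n} \<Longrightarrow> (r, v) \<in> D\<^sup>*"
    and deg: "\<And>v. v \<in> {1..n} \<Longrightarrow> card {u. (u, v) \<in> D} = (if v = r then 0 else 1)"
    using assms by (auto simp: rooted_tree_def)
  have fin: "finite {u. (u, v) \<in> D}" for v
    by (rule finite_subset[of _ "{1..n}"]) (use sub in auto)
  have noparent: "(u, r) \<notin> D" for u
    using deg[OF r] fin[of r] by auto
  have "v = r" if "v \<in> {1..n}" "\<forall>u. (u, v) \<notin> D" for v
    using deg[OF that(1)] that(2) by (simp split: if_splits)
  then show "forest_roots n D = {r}"
    using r noparent unfolding forest_roots_def by blast
  have sv: "single_valued (D\<inverse>)"
  proof (rule single_valuedI)
    fix v u u' assume "(v, u) \<in> D\<inverse>" "(v, u') \<in> D\<inverse>"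
    then have *: "u \<in> {u. (u, v) \<in> D}" "u' \<in> {u. (u, v) \<in> D}" "v \<in> {1..n}" "v \<noteq> r"
      using sub noparent by auto
    then have "card {u. (u, v) \<in> D} = 1"
      using deg by simp
    with * show "u = u'"
      by (metis card_1_singletonE singletonD)
  qed
  have "acyclic D"
  proof (rule acyclicI, rule allI, rule notI)
    fix x assume x: "(x, x) \<in> D\<^sup>+"
    then have "x \<in> {1..n}"
      using sub by (metis SigmaD1 subsetD tranclD)
    \<comment> \<open>A cycle through \<open>z\<close> enters \<open>z\<close> from its only parent
      and hence also passes through that parent. In this way it moves up the path until it reaches
      \<open>r\<close>, which has no parent.\<close>
    from reach[OF this] x have "(r, r) \<in> D\<^sup>+"
    proof (induction rule: rtrancl_induct)
      case (step y z)
      from \<open>(z, z) \<in> D\<^sup>+\<close> obtain y' where y': "(z, y') \<in> D\<^sup>*" "(y', z) \<in> D"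
        by (meson tranclD2)
      then have "y' = y"
        using sv step(2) by (auto simp: single_valued_def)
      with y' step show ?case
        by (metis rtrancl_into_trancl2)
    qed
    then show False
      using noparent by (meson tranclD2)
  qed
  then show "rooted_forest n D"
    using sub sv by (simp add: rooted_forest_def)
qed

text \<open>A forest is a tree exactly when it has one root, that is, \<open>n - 1\<close> edges.
  The root can thus be forgotten and trees summed as bare edge sets.\<close>

lemma ex_rooted_tree_iff:
  assumes "n \<ge> 1"
  shows "(\<exists>r. rooted_tree n r D) \<longleftrightarrow> rooted_forest n D \<and> card D = n - 1"
proof
  assume "\<exists>r. rooted_tree n r D"
  then obtain r where "rooted_tree n r D" ..
  then have "rooted_forest n D" "card (forest_roots n D) = 1"
    using rooted_tree_imp_forest by auto
  then show "rooted_forest n D \<and> card D = n - 1"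
    using card_forest_roots[of n D] by simp
next
  assume D: "rooted_forest n D \<and> card D = n - 1"
  then have "card (forest_roots n D) = 1"
    using card_forest_roots[of n D] assms by simp
  then obtain r where r: "forest_roots n D = {r}"
    by (rule card_1_singletonE)
  have "card {u. (u, v) \<in> D} = (if v = r then 0 else 1)" if v: "v \<in> {1..n}" for v
  proof (cases "v = r")
    case True
    then have "{u. (u, v) \<in> D} = {}"
      using r by (auto simp: forest_roots_def)
    then show ?thesis
      using True by simp
  next
    case False
    then obtain u where "(u, v) \<in> D"
      using r v by (auto simp: forest_roots_def)
    then have "{u. (u, v) \<in> D} = {u}"
      using D by (auto simp: rooted_forest_def single_valued_def)
    then show ?thesis
      using False by simp
  qed
  moreover have "(r, v) \<in> D\<^sup>*" if "v \<in> {1..n}" for v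
    using ex1_forest_root[of n D v] D r that by auto
  moreover have "r \<in> {1..n}"
    using r by (auto simp: forest_roots_def)
  ultimately show "\<exists>r. rooted_tree n r D"
    using D by (auto simp: rooted_tree_def rooted_forest_def)
qed

text \<open>The result depends on \<open>P\<close> only through its size: subsets of
  \<open>P\<close> are forests, and the number of trees containing a forest depends only on its
  number of edges.\<close>

lemma card_rooted_trees_by_common_edges:
  assumes P: "rooted_forest n P" "card P = n - 1" and n: "n \<ge> 1" and k: "k \<le> n - 1"
    and f: "\<And>r D. rooted_tree n r D \<Longrightarrow> f D = card (D \<inter> P)"
  shows "card {(r, D). rooted_tree n r D \<and> f D = k} = (n - 1 choose k) * (n - 1) ^ (n - 1 - k)"
proof -
  define X where "X = {D. rooted_forest n D \<and> card D = n - 1}"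
  have finX: "finite X"
    by (rule finite_subset[of _ "Pow ({1..n} \<times> {1..n})"]) (auto simp: X_def rooted_forest_def)
  have finP: "finite P"
    using P(1) by (rule rooted_forest_finite)
  have X: "D \<in> X \<longleftrightarrow> (\<exists>r. rooted_tree n r D)" for D
    using ex_rooted_tree_iff[OF n] by (simp add: X_def)
  have "bij_betw snd {(r, D). rooted_tree n r D \<and> f D = k} {D \<in> X. card (D \<inter> P) = k}"
    unfolding bij_betw_def
  proof
    show "inj_on snd {(r, D). rooted_tree n r D \<and> f D = k}"
      by (auto simp: inj_on_def dest: rooted_tree_unique_root)
    show "snd ` {(r, D). rooted_tree n r D \<and> f D = k} = {D \<in> X. card (D \<inter> P) = k}"
      using X f by (force simp: image_iff)
  qed
  then have "card {(r, D). rooted_tree n r D \<and> f D = k} = card {D \<in> X. card (D \<inter> P) = k}"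
    by (rule bij_betw_same_card)
  also have "\<dots> = (n - 1 choose k) * (n - 1) ^ (n - 1 - k)"
  proof (rule card_statistic_eq_binomial[OF finX n k])
    fix q :: int
    have "(\<Sum>D\<in>X. (1 - q) ^ card (D \<inter> P)) = (\<Sum>D\<in>X. \<Sum>A\<in>Pow (D \<inter> P). (- q) ^ card A)"
      using sum_Pow_power[of "_ \<inter> P" "- q" 1] finP
      by (intro sum.cong refl) (simp del: Pow_Int_eq)
    also have "\<dots> = (\<Sum>D\<in>X. \<Sum>A | A \<in> Pow P \<and> A \<subseteq> D. (- q) ^ card A)"
      by (intro sum.cong refl) auto
    also have "\<dots> = (\<Sum>A\<in>Pow P. \<Sum>D | D \<in> X \<and> A \<subseteq> D. (- q) ^ card A)"
      using finP finX by (intro sum.swap_restrict) auto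
    also have "\<dots> = (\<Sum>A\<in>Pow P. (- q) ^ card A * int n ^ (card P - card A))"
    proof (intro sum.cong refl)
      fix A assume "A \<in> Pow P"
      then have "card {D \<in> X. A \<subseteq> D} = n ^ (card P - card A)"
        using card_rooted_trees_containing[of n A] P n rooted_forest_subset
        by (auto simp: X_def conj_assoc)
      then show "(\<Sum>D | D \<in> X \<and> A \<subseteq> D. (- q) ^ card A) = (- q) ^ card A * int n ^ (card P - card A)"
        by simp
    qed
    also have "\<dots> = (int n - q) ^ (n - 1)"
      using sum_Pow_power[OF finP, of "- q" "int n"] P by simp
    finally show "(\<Sum>D\<in>X. (1 - q) ^ card (D \<inter> P)) = (int n - q) ^ (n - 1)" .
  qed
  finally show ?thesis .
qed

lemma card_rooted_trees_by_children:
  assumes n: "n \<ge> 1" and k: "k \<le> n - 1"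
  shows "card {(r, D). rooted_tree n r D \<and> card {i. (n, i) \<in> D} = k} =
    (n - 1 choose k) * (n - 1) ^ (n - 1 - k)"
proof (rule card_rooted_trees_by_common_edges[OF _ _ n k])
  \<comment> \<open>The star with root \<open>n\<close>; its edges strictly decrease, which excludes
    cycles.\<close>
  let ?P = "Pair n ` {1..<n}"
  have "?P \<subseteq> less_than\<inverse>"
    by auto
  then have "acyclic ?P"
    by (meson acyclic_converse acyclic_subset wf_acyclic wf_less_than)
  then show "rooted_forest n ?P"
    by (auto simp: rooted_forest_def single_valued_def)
  show "card ?P = n - 1"
    by (simp add: card_image inj_on_def)
  fix r D assume D: "rooted_tree n r D"
  have "(n, n) \<notin> D"
    using rooted_tree_imp_forest(1)[OF D] by (auto simp: rooted_forest_def acyclic_def)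
  moreover have "D \<subseteq> {1..n} \<times> {1..n}"
    using D by (simp add: rooted_tree_def)
  ultimately have "i \<in> {1..<n}" if "(n, i) \<in> D" for i
    using that by (cases "i = n") auto
  then have "D \<inter> ?P = Pair n ` {i. (n, i) \<in> D}"
    by blast
  then show "card {i. (n, i) \<in> D} = card (D \<inter> ?P)"
    by (simp add: card_image inj_on_def)
qed

lemma card_rooted_trees_by_descents:
  assumes n: "n \<ge> 1" and k: "k \<le> n - 1"
  shows "card {(r, D). rooted_tree n r D \<and> card {i. (i + 1, i) \<in> D} = k} =
    (n - 1 choose k) * (n - 1) ^ (n - 1 - k)"
proof (rule card_rooted_trees_by_common_edges[OF _ _ n k])
  \<comment> \<open>The path from \<open>n\<close> down to \<open>1\<close>, again with strictly
    decreasing edges.\<close>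
  let ?P = "(\<lambda>i. (i + 1, i)) ` {1..<n}"
  have "?P \<subseteq> less_than\<inverse>"
    by auto
  then have "acyclic ?P"
    by (meson acyclic_converse acyclic_subset wf_acyclic wf_less_than)
  then show "rooted_forest n ?P"
    by (auto simp: rooted_forest_def single_valued_def)
  show "card ?P = n - 1"
    by (simp add: card_image inj_on_def)
  fix r D assume D: "rooted_tree n r D"
  have "D \<subseteq> {1..n} \<times> {1..n}"
    using D by (simp add: rooted_tree_def)
  then have "D \<inter> ?P = (\<lambda>i. (i + 1, i)) ` {i. (i + 1, i) \<in> D}"
    by auto
  then show "card {i. (i + 1, i) \<in> D} = card (D \<inter> ?P)"
    by (simp add: card_image inj_on_def)
qed

section \<open>Colorings avoiding the Shi arrangement\<close>

text \<open>A placement of the labels \<open>1, ..., n\<close> on a row of positions is encoded by the function that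
  assigns to each label the number of empty positions before it (\<open>squeeze\<close>). As labels within a run
  of occupied positions descend, the placement can be recovered (\<open>spread\<close>).\<close>
definition lex_before :: "(nat \<Rightarrow> int) \<Rightarrow> nat \<Rightarrow> nat \<Rightarrow> bool" where
  "lex_before f j i \<longleftrightarrow> f j < f i \<or> f j = f i \<and> i < j"

definition spread :: "nat \<Rightarrow> (nat \<Rightarrow> int) \<Rightarrow> nat \<Rightarrow> int" where
  "spread n f = (\<lambda>i\<in>{1..n}. f i + int (card {j \<in> {1..n}. lex_before f j i}))"

definition squeeze :: "nat \<Rightarrow> (nat \<Rightarrow> int) \<Rightarrow> nat \<Rightarrow> int" where
  "squeeze n x = (\<lambda>i\<in>{1..n}. x i - int (card {j \<in> {1..n}. x j < x i}))"

definition row_placements :: "nat \<Rightarrow> int \<Rightarrow> (nat \<Rightarrow> int) set" where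
  "row_placements n N = {x \<in> {1..n} \<rightarrow>\<^sub>E {0..<N}. inj_on x {1..n} \<and>
     (\<forall>i\<in>{1..n}. \<forall>j\<in>{1..n}. i < j \<longrightarrow> x j \<noteq> x i + 1)}"

text \<open>Everything before \<open>j\<close> is also before \<open>i\<close>, and so is
  \<open>j\<close> itself, hence the count grows by at least one. An increase of \<open>f\<close>
  adds at least one more, which leaves an empty position in between.\<close>

lemma spread_less_aux:
  assumes "i \<in> {1..n}" "j \<in> {1..n}" "lex_before f j i"
  shows "spread n f j < spread n f i" "f j < f i \<Longrightarrow> spread n f j + 1 < spread n f i"
proof -
  have "{k \<in> {1..n}. lex_before f k j} \<subset> {k \<in> {1..n}. lex_before f k i}"
    using assms by (auto simp: lex_before_def)
  then have "card {k \<in> {1..n}. lex_before f k j} < card {k \<in> {1..n}. lex_before f k i}"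
    by (intro psubset_card_mono) auto
  then show "spread n f j < spread n f i" "f j < f i \<Longrightarrow> spread n f j + 1 < spread n f i"
    using assms by (auto simp: spread_def lex_before_def)
qed

lemma spread_less_iff:
  assumes "i \<in> {1..n}" "j \<in> {1..n}"
  shows "spread n f j < spread n f i \<longleftrightarrow> lex_before f j i"
proof -
  have "lex_before f j i \<or> i = j \<or> lex_before f i j"
    by (auto simp: lex_before_def)
  then show ?thesis
    using spread_less_aux(1)[OF assms, of f] spread_less_aux(1)[OF assms(2,1), of f] by fastforce
qed

text \<open>The squeezed values differ by the number of empty positions between \<open>x j\<close>
  and \<open>x i\<close>. If there is one, the values already compare; if there is none,
  \<open>j\<close> and \<open>i\<close> lie in one run, in which labels descend.\<close>

lemma lex_before_squeeze_aux:
  assumes x: "x \<in> row_placements n N" and i: "i \<in> {1..n}" and j: "j \<in> {1..n}" and less: "x j < x i"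
  shows "lex_before (squeeze n x) j i"
proof -
  have inj: "inj_on x {1..n}" and desc: "\<And>i j. \<lbrakk>i \<in> {1..n}; j \<in> {1..n}; i < j\<rbrakk> \<Longrightarrow> x j \<noteq> x i + 1"
    using x by (auto simp: row_placements_def)
  define M where "M = {k \<in> {1..n}. x j \<le> x k \<and> x k < x i}"
  have sub: "x ` M \<subseteq> {x j..<x i}"
    by (auto simp: M_def)
  have "inj_on x M"
    using inj by (rule inj_on_subset) (auto simp: M_def)
  then have cardM: "card (x ` M) = card M"
    by (rule card_image)
  have "{k \<in> {1..n}. x k < x i} = {k \<in> {1..n}. x k < x j} \<union> M"
    using less by (auto simp: M_def)
  moreover have "card ({k \<in> {1..n}. x k < x j} \<union> M) = card {k \<in> {1..n}. x k < x j} + card M"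
    by (rule card_Un_disjoint) (auto simp: M_def)
  ultimately have "card {k \<in> {1..n}. x k < x i} = card {k \<in> {1..n}. x k < x j} + card M"
    by (simp only:)
  then have eq: "squeeze n x i - squeeze n x j = x i - x j - int (card (x ` M))"
    using i j cardM by (simp add: squeeze_def)
  have le: "int (card (x ` M)) \<le> x i - x j"
    using card_mono[OF _ sub] less by simp
  show ?thesis
  proof (cases "int (card (x ` M)) = x i - x j")
    case False
    then show ?thesis
      using eq le by (simp add: lex_before_def)
  next
    case True
    then have full: "x ` M = {x j..<x i}"
      using sub less by (intro card_subset_eq) auto
    \<comment> \<open>No position between \<open>x j\<close> and \<open>x i\<close> is empty, so labels descend from \<open>j\<close> to \<open>i\<close>.\<close>
    have "p \<le> x i \<longrightarrow> (\<forall>k\<in>{1..n}. x k = p \<longrightarrow> k \<le> j)" if "x j \<le> p" for p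
      using that
    proof (induction p rule: int_ge_induct)
      case base
      show ?case
        using inj_onD[OF inj _ _ j] by fastforce
    next
      case (step p)
      show ?case
      proof (intro impI ballI)
        fix k assume k: "k \<in> {1..n}" "x k = p + 1" and "p + 1 \<le> x i"
        then have "p \<in> x ` M"
          using full step by simp
        then obtain k' where k': "k' \<in> {1..n}" "x k' = p"
          by (auto simp: M_def)
        then have "k' \<le> j"
          using step \<open>p + 1 \<le> x i\<close> by simp
        moreover have "\<not> k' < k"
          using desc[OF k'(1) k(1)] k k' by auto
        ultimately show "k \<le> j"
          by simp
      qed
    qed
    from this[of "x i"] have "i \<le> j"
      using i less by simp
    moreover have "i \<noteq> j"
      using less by auto
    ultimately show ?thesis
      using eq True by (simp add: lex_before_def)
  qed
qed

lemma lex_before_squeeze_iff: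
  assumes x: "x \<in> row_placements n N" and i: "i \<in> {1..n}" and j: "j \<in> {1..n}"
  shows "lex_before (squeeze n x) j i \<longleftrightarrow> x j < x i"
proof -
  have "x j < x i \<or> i = j \<or> x i < x j"
    using x i j unfolding row_placements_def inj_on_def by (metis (mono_tags, lifting) linorder_neqE mem_Collect_eq)
  moreover have "\<not> lex_before (squeeze n x) i i"
    by (simp add: lex_before_def)
  moreover have "\<not> lex_before (squeeze n x) j i" if "lex_before (squeeze n x) i j"
    using that by (auto simp: lex_before_def)
  ultimately show ?thesis
    using lex_before_squeeze_aux[OF x i j] lex_before_squeeze_aux[OF x j i] by fastforce
qed

lemma spread_in_row_placements:
  assumes f: "f \<in> {1..n} \<rightarrow>\<^sub>E {0..<int m + 1}"
  shows "spread n f \<in> row_placements n (int m + int n)"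
proof -
  have "spread n f i < int m + int n" "0 \<le> spread n f i" if i: "i \<in> {1..n}" for i
  proof -
    have "{j \<in> {1..n}. lex_before f j i} \<subseteq> {1..n} - {i}"
      by (auto simp: lex_before_def)
    from card_mono[OF _ this] have "card {j \<in> {1..n}. lex_before f j i} < n"
      using i by auto
    moreover have "0 \<le> f i" "f i \<le> int m"
      using f i by (fastforce simp: PiE_iff)+
    ultimately show "spread n f i < int m + int n" "0 \<le> spread n f i"
      using i by (simp_all add: spread_def)
  qed
  then have "spread n f \<in> {1..n} \<rightarrow>\<^sub>E {0..<int m + int n}"
    by (auto simp: PiE_iff) (auto simp: spread_def)
  moreover have "inj_on (spread n f) {1..n}"
  proof (rule inj_onI)
    fix i j assume ij: "i \<in> {1..n}" "j \<in> {1..n}" "spread n f i = spread n f j"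
    then have "\<not> lex_before f i j" "\<not> lex_before f j i"
      using spread_less_iff[of i n j f] spread_less_iff[of j n i f] by auto
    then show "i = j"
      by (auto simp: lex_before_def)
  qed
  moreover have "spread n f j \<noteq> spread n f i + 1" if ij: "i \<in> {1..n}" "j \<in> {1..n}" "i < j" for i j
  proof
    \<comment> \<open>Here \<open>i\<close> comes before \<open>j\<close> although
      \<open>i < j\<close>, so the tie-break cannot be the reason and \<open>f\<close> must
      increase; but an increase leaves a gap.\<close>
    assume eq: "spread n f j = spread n f i + 1"
    then have "lex_before f i j"
      using spread_less_iff[OF ij(2,1), of f] by simp
    moreover from this have "f i < f j"
      using ij by (simp add: lex_before_def)
    ultimately show False
      using spread_less_aux(2)[OF ij(2,1)] eq by fastforce
  qed
  ultimately show ?thesis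
    by (simp add: row_placements_def)
qed

text \<open>At most \<open>x i\<close> labels lie before position \<open>x i\<close> and at most
  \<open>m + n - x i\<close> at or after it, while there are \<open>n\<close> labels in all.\<close>

lemma squeeze_in_PiE:
  assumes x: "x \<in> row_placements n (int m + int n)"
  shows "squeeze n x \<in> {1..n} \<rightarrow>\<^sub>E {0..<int m + 1}"
proof -
  have inj: "inj_on x {1..n}" and ran: "\<And>i. i \<in> {1..n} \<Longrightarrow> 0 \<le> x i \<and> x i < int m + int n"
    using x by (auto simp: row_placements_def PiE_iff)
  have "0 \<le> squeeze n x i \<and> squeeze n x i \<le> int m" if i: "i \<in> {1..n}" for i
  proof -
    let ?L = "{j \<in> {1..n}. x j < x i}" and ?U = "{j \<in> {1..n}. x i \<le> x j}"
    have "card ?L = card (x ` ?L)"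
      by (rule card_image[symmetric], rule inj_on_subset[OF inj]) auto
    also have "\<dots> \<le> card {0..<x i}"
      using ran by (intro card_mono) auto
    finally have L: "int (card ?L) \<le> x i"
      using ran[OF i] by (simp add: le_nat_iff)
    have "card ?U = card (x ` ?U)"
      by (rule card_image[symmetric], rule inj_on_subset[OF inj]) auto
    also have "\<dots> \<le> card {x i..<int m + int n}"
      using ran by (intro card_mono) auto
    finally have U: "int (card ?U) \<le> int m + int n - x i"
      using ran[OF i] by (simp add: le_nat_iff)
    have "?L \<union> ?U = {1..n}"
      by auto
    then have "card ?L + card ?U = n"
      using card_Un_disjoint[of ?L ?U] by fastforce
    then show ?thesis
      using L U i by (simp add: squeeze_def)
  qed
  then show ?thesis
    by (fastforce simp: PiE_iff squeeze_def)
qed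

text \<open>Of the \<open>m + n\<close> positions \<open>m\<close> stay empty, so each label
  independently chooses one of \<open>m + 1\<close> values for the number of empty positions before
  it.\<close>

lemma card_row_placements: "card (row_placements n (int m + int n)) = (m + 1) ^ n"
proof -
  have "bij_betw (spread n) ({1..n} \<rightarrow>\<^sub>E {0..<int m + 1}) (row_placements n (int m + int n))"
  proof (rule bij_betw_byWitness[where f' = "squeeze n"]; intro ballI subsetI)
    fix f assume f: "f \<in> {1..n} \<rightarrow>\<^sub>E {0..<int m + 1}"
    have "squeeze n (spread n f) i = f i" if i: "i \<in> {1..n}" for i
    proof -
      have "{j \<in> {1..n}. spread n f j < spread n f i} = {j \<in> {1..n}. lex_before f j i}"
        using spread_less_iff[OF i] by blast
      then show ?thesis
        using i by (simp add: squeeze_def) (simp add: spread_def)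
    qed
    then show "squeeze n (spread n f) = f"
      using f by (intro extensionalityI[of _ "{1..n}"]) (auto simp: squeeze_def PiE_def)
  next
    fix x assume x: "x \<in> row_placements n (int m + int n)"
    have "spread n (squeeze n x) i = x i" if i: "i \<in> {1..n}" for i
    proof -
      have "{j \<in> {1..n}. lex_before (squeeze n x) j i} = {j \<in> {1..n}. x j < x i}"
        using lex_before_squeeze_iff[OF x i] by blast
      then show ?thesis
        using i by (simp add: spread_def) (simp add: squeeze_def)
    qed
    then show "spread n (squeeze n x) = x"
      using x by (intro extensionalityI[of _ "{1..n}"]) (auto simp: spread_def row_placements_def PiE_def)
  qed (use spread_in_row_placements squeeze_in_PiE in blast)+
  then have "card (row_placements n (int m + int n)) = card ({1..n} \<rightarrow>\<^sub>E {0..<int m + 1})"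
    by (simp add: bij_betw_same_card)
  then show ?thesis
    by (simp add: card_PiE nat_add_distrib)
qed

text \<open>Two uses: \<open>K = UNIV\<close> rotates the color circle, and \<open>K\<close> a
  connected component of an edge set changes a potential across an edge leaving that
  component.\<close>

definition shift_on :: "nat \<Rightarrow> int \<Rightarrow> nat set \<Rightarrow> int \<Rightarrow> (nat \<Rightarrow> int) \<Rightarrow> nat \<Rightarrow> int" where
  "shift_on n q K c x = (\<lambda>i\<in>{1..n}. if i \<in> K then (x i + c) mod q else x i)"

lemma shift_on_PiE:
  assumes "q > 0" "x \<in> {1..n} \<rightarrow>\<^sub>E {0..<q}"
  shows "shift_on n q K c x \<in> {1..n} \<rightarrow>\<^sub>E {0..<q}"
  using assms by (auto simp: shift_on_def PiE_iff)

lemma shift_on_shift_on: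
  assumes "x \<in> {1..n} \<rightarrow>\<^sub>E {0..<q}" "q dvd c + d"
  shows "shift_on n q K c (shift_on n q K d x) = x"
proof (rule extensionalityI[of _ "{1..n}"])
  fix i assume i: "i \<in> {1..n}"
  then have "x i \<in> {0..<q}"
    using assms(1) by (auto simp: PiE_iff)
  moreover have "((x i + d) mod q + c) mod q = (x i + (c + d)) mod q"
    by (simp add: mod_simps algebra_simps)
  moreover have "\<dots> = x i mod q"
    using assms(2) by (metis add.right_neutral dvd_eq_mod_eq_0 mod_add_right_eq)
  ultimately show "shift_on n q K c (shift_on n q K d x) i = x i"
    using i by (simp add: shift_on_def)
qed (use assms in \<open>auto simp: shift_on_def PiE_def\<close>)

lemma dvd_mod_diff_iff:
  fixes a b c q :: int
  shows "q dvd a mod q - b mod q - c \<longleftrightarrow> q dvd a - b - c"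
proof -
  have "a mod q - b mod q - c = (a - b - c) + (b div q - a div q) * q"
    by (simp add: minus_div_mult_eq_mod[symmetric] left_diff_distrib)
  then show ?thesis
    by (simp only: dvd_add_times_triv_right_iff)
qed

definition shi_colorings :: "nat \<Rightarrow> int \<Rightarrow> (nat \<Rightarrow> int) set" where
  "shi_colorings n q = {x \<in> {1..n} \<rightarrow>\<^sub>E {0..<q}. \<forall>i\<in>{1..n}. \<forall>j\<in>{1..n}.
     i < j \<longrightarrow> \<not> q dvd x j - x i \<and> \<not> q dvd x j - x i - 1}"

lemma int_dvd_small_iff:
  fixes z q :: int
  assumes "\<bar>z\<bar> < q"
  shows "q dvd z \<longleftrightarrow> z = 0"
  using assms dvd_imp_le_int[of z q] by auto

lemma inj_on_shi_coloring:
  assumes "x \<in> shi_colorings n q"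
  shows "inj_on x {1..n}"
proof (rule linorder_inj_onI')
  fix i j assume "i \<in> {1..n}" "j \<in> {1..n}" "i < j"
  then have "\<not> q dvd x j - x i"
    using assms by (simp add: shi_colorings_def)
  then show "x i \<noteq> x j"
    by auto
qed

lemma shi_colorings_avoiding_last:
  "{x \<in> shi_colorings n q. q - 1 \<notin> x ` {1..n}} = row_placements n (q - 1)"
proof (intro set_eqI iffI)
  fix x assume x: "x \<in> {x \<in> shi_colorings n q. q - 1 \<notin> x ` {1..n}}"
  then have ran: "x i \<in> {0..<q - 1}" if "i \<in> {1..n}" for i
  proof -
    have "x i \<in> {0..<q}" "x i \<noteq> q - 1"
      using x that unfolding shi_colorings_def by (blast, force)
    then show ?thesis
      by auto
  qed
  have desc: "x j \<noteq> x i + 1" if "i \<in> {1..n}" "j \<in> {1..n}" "i < j" for i j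
  proof
    assume "x j = x i + 1"
    then have "q dvd x j - x i - 1"
      by simp
    then show False
      using x that unfolding shi_colorings_def by blast
  qed
  have "inj_on x {1..n}"
    using x inj_on_shi_coloring by blast
  moreover have "x \<in> {1..n} \<rightarrow>\<^sub>E {0..<q - 1}"
    using x ran by (simp add: shi_colorings_def PiE_iff)
  ultimately show "x \<in> row_placements n (q - 1)"
    using desc by (simp add: row_placements_def)
next
  fix x assume x: "x \<in> row_placements n (q - 1)"
  then have ran: "0 \<le> x i \<and> x i < q - 1" if "i \<in> {1..n}" for i
    using that by (auto simp: row_placements_def PiE_iff)
  have "\<not> q dvd x j - x i \<and> \<not> q dvd x j - x i - 1" if ij: "i \<in> {1..n}" "j \<in> {1..n}" "i < j" for i j
  proof -
    have "inj_on x {1..n}" "x j \<noteq> x i + 1"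
      using x ij by (simp_all add: row_placements_def)
    then have "x j \<noteq> x i" "x j \<noteq> x i + 1"
      using ij inj_onD by fastforce+
    moreover have "\<bar>x j - x i\<bar> < q" "\<bar>x j - x i - 1\<bar> < q"
      using ran[OF ij(1)] ran[OF ij(2)] by linarith+
    ultimately show ?thesis
      by (simp add: int_dvd_small_iff)
  qed
  moreover have "x \<in> {1..n} \<rightarrow>\<^sub>E {0..<q}"
    using x PiE_mono[of "{1..n}" "\<lambda>_. {0..<q - 1}" "\<lambda>_. {0..<q}"]
    by (auto simp: row_placements_def)
  ultimately have "x \<in> shi_colorings n q"
    by (simp add: shi_colorings_def)
  moreover have "q - 1 \<notin> x ` {1..n}"
    using ran by fastforce
  ultimately show "x \<in> {x \<in> shi_colorings n q. q - 1 \<notin> x ` {1..n}}"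
    by blast
qed

lemma shift_shi_colorings:
  assumes "q > 0" and x: "x \<in> shi_colorings n q" and p: "p \<notin> x ` {1..n}" "p \<in> {0..<q}"
    and pc: "p + c \<in> {0..<q}"
  shows "shift_on n q UNIV c x \<in> shi_colorings n q" "p + c \<notin> shift_on n q UNIV c x ` {1..n}"
proof -
  have d: "q dvd (x j + c) mod q - (x i + c) mod q - d \<longleftrightarrow> q dvd x j - x i - d" for i j d
    by (simp add: dvd_mod_diff_iff)
  show "shift_on n q UNIV c x \<in> shi_colorings n q"
    unfolding shi_colorings_def
  proof (intro CollectI conjI ballI impI)
    show "shift_on n q UNIV c x \<in> {1..n} \<rightarrow>\<^sub>E {0..<q}"
      using x shift_on_PiE[OF \<open>q > 0\<close>] by (simp add: shi_colorings_def)
    fix i j assume ij: "i \<in> {1..n}" "j \<in> {1..n}" "i < j"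
    then have "\<not> q dvd x j - x i" "\<not> q dvd x j - x i - 1"
      using x by (simp_all add: shi_colorings_def)
    then show "\<not> q dvd shift_on n q UNIV c x j - shift_on n q UNIV c x i"
      "\<not> q dvd shift_on n q UNIV c x j - shift_on n q UNIV c x i - 1"
      using ij d[of j i 0] d[of j i 1] by (simp_all add: shift_on_def)
  qed
  show "p + c \<notin> shift_on n q UNIV c x ` {1..n}"
  proof
    assume "p + c \<in> shift_on n q UNIV c x ` {1..n}"
    then obtain i where i: "i \<in> {1..n}" "(p + c) mod q = (x i + c) mod q"
      using pc by (auto simp: shift_on_def)
    then have "q dvd p - x i"
      by (simp add: mod_eq_dvd_iff)
    moreover have "x i \<in> {0..<q}"
      using x i by (auto simp: shi_colorings_def PiE_iff)
    ultimately have "p = x i"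
      using p(2) int_dvd_small_iff[of "p - x i" q] by auto
    with i p(1) show False
      by blast
  qed
qed

text \<open>Double count of pairs of a coloring and an unused color: rotating the color circle moves the
  unused color to \<open>q - 1\<close>, which cuts the circle into a row.\<close>
lemma card_shi_colorings:
  assumes n: "n \<ge> 1" and q: "q > int n"
  shows "int (card (shi_colorings n q)) = q * (q - int n) ^ (n - 1)"
proof -
  \<comment> \<open>The number of positions that stay empty when \<open>n\<close> labels are placed
    in the row of \<open>q - 1\<close> positions left by the cut.\<close>
  define m where "m = nat (q - 1 - int n)"
  have m: "q - 1 = int m + int n" "int m + 1 = q - int n"
    using q by (auto simp: m_def)
  define Y where "Y = (\<lambda>p. {x \<in> shi_colorings n q. p \<notin> x ` {1..n}})"
  have fin: "finite (shi_colorings n q)"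
    by (rule finite_subset[of _ "{1..n} \<rightarrow>\<^sub>E {0..<q}"]) (auto simp: shi_colorings_def intro: finite_PiE)
  have "card (Y p) = (m + 1) ^ n" if p: "p \<in> {0..<q}" for p
  proof -
    have "bij_betw (shift_on n q UNIV (q - 1 - p)) (Y p) (Y (q - 1))"
    proof (rule bij_betw_byWitness[where f' = "shift_on n q UNIV (p - (q - 1))"]; intro ballI subsetI)
      fix x assume x: "x \<in> Y p"
      then show "shift_on n q UNIV (p - (q - 1)) (shift_on n q UNIV (q - 1 - p) x) = x"
        by (intro shift_on_shift_on) (auto simp: Y_def shi_colorings_def)
    next
      fix x assume x: "x \<in> Y (q - 1)"
      then show "shift_on n q UNIV (q - 1 - p) (shift_on n q UNIV (p - (q - 1)) x) = x"
        by (intro shift_on_shift_on) (auto simp: Y_def shi_colorings_def)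
    next
      fix y assume "y \<in> shift_on n q UNIV (q - 1 - p) ` Y p"
      then show "y \<in> Y (q - 1)"
        using shift_shi_colorings[of q _ n p "q - 1 - p"] p q by (fastforce simp: Y_def)
    next
      fix y assume "y \<in> shift_on n q UNIV (p - (q - 1)) ` Y (q - 1)"
      then show "y \<in> Y p"
        using shift_shi_colorings[of q _ n "q - 1" "p - (q - 1)"] p q by (auto simp: Y_def)
    qed
    then have "card (Y p) = card (Y (q - 1))"
      by (rule bij_betw_same_card)
    then show ?thesis
      using shi_colorings_avoiding_last[of n q] card_row_placements[of n m] m by (simp add: Y_def)
  qed
  then have "(\<Sum>x\<in>shi_colorings n q. card {p \<in> {0..<q}. p \<notin> x ` {1..n}}) = (m + 1) ^ n * card {0..<q}"
    unfolding Y_def by (intro sum_multicount fin) auto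
  moreover have "card {p \<in> {0..<q}. p \<notin> x ` {1..n}} = m + 1" if x: "x \<in> shi_colorings n q" for x
  proof -
    have "inj_on x {1..n}"
      using x by (rule inj_on_shi_coloring)
    then have "card (x ` {1..n}) = n"
      by (simp add: card_image)
    moreover have "x ` {1..n} \<subseteq> {0..<q}"
      using x by (auto simp: shi_colorings_def PiE_iff)
    moreover have "{p \<in> {0..<q}. p \<notin> x ` {1..n}} = {0..<q} - x ` {1..n}"
      by auto
    ultimately show ?thesis
      using q by (simp add: card_Diff_subset m_def)
  qed
  ultimately have "card (shi_colorings n q) * (m + 1) = (m + 1) ^ n * nat q"
    by simp
  also have "\<dots> = (m + 1) ^ (n - 1) * nat q * (m + 1)"
    using n by (metis mult.assoc mult.commute power_minus_mult less_eq_Suc_le One_nat_def)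
  finally have "card (shi_colorings n q) = (m + 1) ^ (n - 1) * nat q"
    by (metis add_gr_0 mult_right_cancel not_gr_zero zero_less_one)
  then have "int (card (shi_colorings n q)) = (int m + 1) ^ (n - 1) * q"
    using q by (simp add: add.commute)
  then show ?thesis
    unfolding m(2) by simp
qed

section \<open>Circles and spanning trees\<close>

definition link :: "gedge set \<Rightarrow> nat rel" where
  "link S = {(a, b). \<exists>e\<in>S. joins e a b}"

text \<open>Membership of \<open>e\<close> in the closure of \<open>S\<close> in the graphic
  matroid.\<close>

definition linked :: "gedge set \<Rightarrow> gedge \<Rightarrow> bool" where
  "linked S e \<longleftrightarrow> (fst e, fst (snd e)) \<in> (link S)\<^sup>*"

lemma joins_commute: "joins e u v \<longleftrightarrow> joins e v u"
  by (auto simp: joins_def)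

lemma link_rtrancl_commute: "(u, v) \<in> (link S)\<^sup>* \<longleftrightarrow> (v, u) \<in> (link S)\<^sup>*"
proof -
  have "sym (link S)"
    by (auto simp: sym_def link_def joins_commute)
  then show ?thesis
    using sym_rtrancl symD by metis
qed

lemma linked_iff: "joins e u v \<Longrightarrow> linked S e \<longleftrightarrow> (u, v) \<in> (link S)\<^sup>*"
  using link_rtrancl_commute by (auto simp: joins_def linked_def)

lemma linked_mono: "linked S e \<Longrightarrow> S \<subseteq> T \<Longrightarrow> linked T e"
  unfolding linked_def link_def
  by (erule rtrancl_mono[THEN subsetD, rotated]) blast

lemma linked_member: "e \<in> S \<Longrightarrow> linked S e"
  unfolding linked_def link_def joins_def by blast

lemma link_rtrancl_subst:
  assumes "\<And>e. e \<in> S \<Longrightarrow> linked T e" and "(u, v) \<in> (link S)\<^sup>*"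
  shows "(u, v) \<in> (link T)\<^sup>*"
  using assms(2)
proof (induction rule: rtrancl_induct)
  case (step v w)
  then obtain e where "e \<in> S" "joins e v w"
    by (auto simp: link_def)
  then have "(v, w) \<in> (link T)\<^sup>*"
    using assms(1) linked_iff by blast
  with step.IH show ?case
    by (rule rtrancl_trans)
qed simp

text \<open>Idempotence of closure: a path through \<open>S\<close> is rerouted edge by edge through
  \<open>T\<close>.\<close>

lemma linked_subst: "linked S e \<Longrightarrow> (\<And>f. f \<in> S \<Longrightarrow> linked T f) \<Longrightarrow> linked T e"
  using link_rtrancl_subst unfolding linked_def by blast

lemma link_rtrancl_imp_simple_path:
  assumes "(u, v) \<in> (link S)\<^sup>*"
  shows "\<exists>vs es. length vs = Suc (length es) \<and> vs ! 0 = u \<and> vs ! length es = v \<and> distinct vs \<and>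
    set es \<subseteq> S \<and> (\<forall>t<length es. joins (es ! t) (vs ! t) (vs ! Suc t))"
  using assms
proof (induction rule: rtrancl_induct)
  case base
  show ?case
    by (rule exI[of _ "[u]"], rule exI[of _ "[]"]) simp
next
  case (step v w)
  then obtain vs es where p: "length vs = Suc (length es)" "vs ! 0 = u" "vs ! length es = v" "distinct vs"
    "set es \<subseteq> S" "\<forall>t<length es. joins (es ! t) (vs ! t) (vs ! Suc t)"
    by blast
  obtain e where e: "e \<in> S" "joins e v w"
    using step by (auto simp: link_def)
  show ?case
  proof (cases "w \<in> set vs")
    \<comment> \<open>When the walk returns to a vertex of the path, the path is cut there instead
      of extended, so its vertices stay distinct.\<close>
    case True
    then obtain t where t: "t < length vs" "vs ! t = w"
      by (auto simp: in_set_conv_nth)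
    show ?thesis
    proof (rule exI[of _ "take (Suc t) vs"], rule exI[of _ "take t es"], intro conjI)
      show "set (take t es) \<subseteq> S"
        using p(5) set_take_subset[of t es] by simp
    qed (use p t in auto)
  next
    case False
    show ?thesis
      by (rule exI[of _ "vs @ [w]"], rule exI[of _ "es @ [e]"])
        (use p e False in \<open>auto simp: nth_append less_Suc_eq\<close>)
  qed
qed

text \<open>A simple path in \<open>S\<close> between the ends of \<open>e\<close> closes up with
  \<open>e\<close>; a path of one edge gives a pair of parallel edges.\<close>

lemma linked_imp_circle:
  assumes "linked S e" "e \<notin> S" "fst e \<noteq> fst (snd e)"
  shows "\<exists>C. is_circle C \<and> C \<subseteq> insert e S"
proof -
  obtain vs es where p: "length vs = Suc (length es)" "vs ! 0 = fst e" "vs ! length es = fst (snd e)"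
    "distinct vs" "set es \<subseteq> S" and joins: "\<And>t. t < length es \<Longrightarrow> joins (es ! t) (vs ! t) (vs ! Suc t)"
    using link_rtrancl_imp_simple_path assms(1) unfolding linked_def by metis
  have neq: "vs ! s \<noteq> vs ! t" if "s < t" "t < length vs" for s t
    using p(4) that by (simp add: nth_eq_iff_index_eq)
  \<comment> \<open>A repeated edge has the same two ends at both places, so a vertex would recur on
    the path.\<close>
  have "distinct es"
  proof (rule ccontr)
    assume "\<not> distinct es"
    then obtain s t where st: "s < t" "t < length es" "es ! s = es ! t"
      by (metis distinct_conv_nth linorder_neqE_nat)
    then have "joins (es ! t) (vs ! s) (vs ! Suc s)" "joins (es ! t) (vs ! t) (vs ! Suc t)"
      using joins[of s] joins[of t] by simp_all
    then have "vs ! s = vs ! t \<or> vs ! s = vs ! Suc t"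
      by (auto simp: joins_def)
    then show False
      using neq[of s t] neq[of s "Suc t"] st p(1) by simp
  qed
  have "es \<noteq> []"
    using p assms(3) by auto
  have "circle_walk (set (es @ [e])) vs (es @ [e])"
    unfolding circle_walk_def
  proof (intro conjI allI impI)
    show "2 \<le> length vs"
      using p(1) \<open>es \<noteq> []\<close> by (cases es) auto
    show "distinct (es @ [e])"
      using \<open>distinct es\<close> p(5) assms(2) by auto
    fix t assume "t < length vs"
    then show "joins ((es @ [e]) ! t) (vs ! t) (vs ! ((t + 1) mod length vs))"
      using joins[of t] p by (cases "t = length es") (auto simp: nth_append joins_def)
  qed (use p in auto)
  then show ?thesis
    using p(5) unfolding is_circle_def by (intro exI[of _ "set (es @ [e])"]) auto
qed

lemma circle_walk_linked:
  assumes w: "circle_walk C vs es" and "e \<in> C"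
  shows "linked (C - {e}) e"
proof -
  define m where "m = length vs"
  have m: "m \<ge> 2" "length es = m" "distinct es" "set es = C"
    and joins: "\<And>t. t < m \<Longrightarrow> joins (es ! t) (vs ! t) (vs ! ((t + 1) mod m))"
    using w by (auto simp: circle_walk_def m_def)
  obtain s where s: "s < m" "es ! s = e"
    using \<open>e \<in> C\<close> m by (auto simp: in_set_conv_nth)
  \<comment> \<open>The walk starts at the far end of \<open>e\<close> and follows the circle,
    wrapping around modulo \<open>m\<close>. After \<open>m - 1\<close> steps it is back at position
    \<open>s\<close> without having used \<open>e\<close>, the edge of index
    \<open>s\<close>.\<close>
  have path: "(vs ! ((s + 1) mod m), vs ! ((s + 1 + k) mod m)) \<in> (link (C - {e}))\<^sup>*" if "k \<le> m - 1" for k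
    using that
  proof (induction k)
    case (Suc k)
    let ?t = "(s + 1 + k) mod m"
    have "?t < m"
      using m by simp
    moreover have "?t \<noteq> s"
    proof (cases "s + 1 + k < m")
      case False
      then have "?t = s + 1 + k - m"
        using s Suc.prems by (simp add: le_mod_geq)
      then show ?thesis
        using False Suc.prems m(1) by linarith
    qed simp
    ultimately have "es ! ?t \<in> C - {e}"
      using m s nth_eq_iff_index_eq[of es ?t s] nth_mem[of ?t es] by auto
    moreover have "joins (es ! ?t) (vs ! ?t) (vs ! ((s + 1 + Suc k) mod m))"
      using joins[OF \<open>?t < m\<close>] by (simp add: mod_simps)
    ultimately have "(vs ! ?t, vs ! ((s + 1 + Suc k) mod m)) \<in> link (C - {e})"
      by (auto simp: link_def)
    with Suc show ?case
      by (meson Suc_leD rtrancl.rtrancl_into_rtrancl)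
  qed simp
  have "s + 1 + (m - 1) = s + m"
    using m by simp
  then have "(s + 1 + (m - 1)) mod m = s"
    using s by simp
  with path[of "m - 1"] have "(vs ! ((s + 1) mod m), vs ! s) \<in> (link (C - {e}))\<^sup>*"
    by simp
  moreover have "joins e (vs ! ((s + 1) mod m)) (vs ! s)"
    using joins[OF s(1)] s joins_commute by simp
  ultimately show ?thesis
    by (simp add: linked_iff)
qed

section \<open>Forests, connectivity and basis exchange\<close>

lemma finite_shi_edges [simp]: "finite (shi_edges n)"
  by (rule finite_subset[of _ "{1..n} \<times> {1..n} \<times> {0, 1}"]) (auto simp: shi_edges_def)

lemma shi_edgeD:
  assumes "e \<in> shi_edges n"
  shows "fst e \<in> {1..n}" "fst (snd e) \<in> {1..n}" "fst e < fst (snd e)"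
  using assms by (auto simp: shi_edges_def)

lemma is_forest_subset: "is_forest S \<Longrightarrow> T \<subseteq> S \<Longrightarrow> is_forest T"
  unfolding is_forest_def by blast

lemma forest_not_linked:
  assumes "is_forest S" "S \<subseteq> shi_edges n" "e \<in> S"
  shows "\<not> linked (S - {e}) e"
proof
  assume "linked (S - {e}) e"
  moreover have "fst e \<noteq> fst (snd e)"
    using shi_edgeD(3)[of e n] assms by auto
  ultimately obtain C where "is_circle C" "C \<subseteq> insert e (S - {e})"
    using linked_imp_circle[of "S - {e}" e] by blast
  then show False
    using assms unfolding is_forest_def by blast
qed

lemma is_forest_insert:
  assumes "is_forest S" "\<not> linked S e"
  shows "is_forest (insert e S)"
  unfolding is_forest_def
proof (intro allI impI notI)
  fix C assume C: "C \<subseteq> insert e S" "is_circle C"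
  then obtain vs es where w: "circle_walk C vs es"
    by (auto simp: is_circle_def)
  show False
  proof (cases "e \<in> C")
    case True
    then have "linked (C - {e}) e"
      using circle_walk_linked[OF w] by blast
    then show False
      using linked_mono[of _ _ S] C assms(2) by blast
  next
    case False
    then show False
      using C assms(1) unfolding is_forest_def by blast
  qed
qed

lemma connected_on_iff: "connected_on n B \<longleftrightarrow> (\<forall>u\<in>{1..n}. \<forall>v\<in>{1..n}. (u, v) \<in> (link B)\<^sup>*)"
  by (simp add: connected_on_def link_def)

lemma connected_linked: "connected_on n B \<Longrightarrow> e \<in> shi_edges n \<Longrightarrow> linked B e"
  using shi_edgeD unfolding connected_on_iff linked_def by blast

text \<open>Any two vertices are joined by an edge of gain 0, so linking all edges connects all
  vertices.\<close>

lemma connected_onI: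
  assumes "\<And>e. e \<in> shi_edges n \<Longrightarrow> linked B e"
  shows "connected_on n B"
  unfolding connected_on_iff
proof (intro ballI)
  have *: "(u, v) \<in> (link B)\<^sup>*" if "u \<in> {1..n}" "v \<in> {1..n}" "u < v" for u v
    using that assms[of "(u, v, 0)"] by (auto simp: shi_edges_def linked_def)
  fix u v assume "u \<in> {1..n}" "v \<in> {1..n}"
  then show "(u, v) \<in> (link B)\<^sup>*"
    using *[of u v] *[of v u] link_rtrancl_commute[of u v] by (cases u v rule: linorder_cases) auto
qed

lemma spanning_tree_exchange:
  assumes B: "spanning_tree n B" and e: "e \<in> B" and f: "f \<in> shi_edges n" "\<not> linked (B - {e}) f"
  shows "spanning_tree n ((B - {e}) \<union> {f})"
proof -
  let ?D = "insert f (B - {e})"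
  have BE: "B \<subseteq> shi_edges n" and forB: "is_forest B" and conB: "connected_on n B"
    using B by (auto simp: spanning_tree_def)
  have forD: "is_forest ?D"
    using is_forest_insert[OF is_forest_subset[OF forB] f(2)] by blast
  \<comment> \<open>Otherwise adding \<open>e\<close> back would make \<open>insert f B\<close> a
    forest, although the spanning tree \<open>B\<close> already links the ends of
    \<open>f\<close>.\<close>
  have "linked ?D e"
  proof (rule ccontr)
    assume e': "\<not> linked ?D e"
    then have "is_forest (insert e ?D)"
      using forD is_forest_insert by blast
    moreover have "insert e ?D = insert f B"
      using e by auto
    ultimately have "is_forest (insert f B)"
      by simp
    moreover have "f \<noteq> e"
      using e' linked_member by blast
    then have "f \<notin> B"
      using f(2) linked_member[of f "B - {e}"] by blast
    ultimately show False
      using forest_not_linked[of "insert f B" n f] connected_linked[OF conB f(1)] BE f(1) by simp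
  qed
  then have "linked ?D g" if "g \<in> B" for g
    using that linked_member[of g ?D] by (cases "g = e") auto
  then have "connected_on n ?D"
    using connected_linked[OF conB] linked_subst by (intro connected_onI) blast
  then show ?thesis
    using forD BE f(1) by (auto simp: spanning_tree_def)
qed

section \<open>Potentials modulo q\<close>

definition satisfies :: "int \<Rightarrow> (nat \<Rightarrow> int) \<Rightarrow> gedge \<Rightarrow> bool" where
  "satisfies q x e \<longleftrightarrow> q dvd x (fst (snd e)) - x (fst e) - snd (snd e)"

text \<open>The intersection of the hyperplanes of \<open>S\<close> modulo \<open>q\<close>. Its
  size detects independence: an edge not linked by \<open>S\<close> divides it by \<open>q\<close>,
  while the last edge of a balanced circle changes nothing.\<close>

definition potentials :: "nat \<Rightarrow> int \<Rightarrow> gedge set \<Rightarrow> (nat \<Rightarrow> int) set" where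
  "potentials n q S = {x \<in> {1..n} \<rightarrow>\<^sub>E {0..<q}. \<forall>e\<in>S. satisfies q x e}"

lemma satisfies_iff_gain_dir:
  assumes "joins e u v"
  shows "satisfies q x e \<longleftrightarrow> q dvd x v - x u - gain_dir e u v"
proof (cases "fst e = u \<and> fst (snd e) = v")
  case True
  then show ?thesis
    by (simp add: satisfies_def gain_dir_def)
next
  case False
  then have e: "fst e = v" "fst (snd e) = u"
    using assms by (auto simp: joins_def)
  have "x u - x v - snd (snd e) = - (x v - x u + snd (snd e))"
    by simp
  then show ?thesis
    using False e by (metis satisfies_def gain_dir_def diff_minus_eq_add dvd_minus_iff)
qed

lemma sum_rotate:
  fixes f :: "nat \<Rightarrow> 'a::comm_monoid_add"
  assumes "m > 0"
  shows "(\<Sum>t<m. f ((t + 1) mod m)) = (\<Sum>t<m. f t)"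
proof -
  obtain k where m: "m = Suc k"
    using assms by (cases m) auto
  have "(\<Sum>t<m. f ((t + 1) mod m)) = (\<Sum>t<k. f (Suc t)) + f 0"
    by (simp add: m)
  also have "\<dots> = (\<Sum>t<m. f t)"
    by (simp only: m sum.lessThan_Suc_shift add.commute)
  finally show ?thesis .
qed

text \<open>Along a circle the differences of \<open>x\<close> cancel, so the last edge is satisfied exactly when the
  total gain vanishes modulo \<open>q\<close>.\<close>
lemma circle_satisfies_iff:
  assumes w: "circle_walk C vs es" and e: "e \<in> C" and sat: "\<And>f. f \<in> C - {e} \<Longrightarrow> satisfies q x f"
  shows "satisfies q x e \<longleftrightarrow>
    q dvd (\<Sum>t<length vs. gain_dir (es ! t) (vs ! t) (vs ! ((t + 1) mod length vs)))"
proof -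
  define m where "m = length vs"
  define g where "g = (\<lambda>t. gain_dir (es ! t) (vs ! t) (vs ! ((t + 1) mod m)))"
  define d where "d = (\<lambda>t. x (vs ! ((t + 1) mod m)) - x (vs ! t) - g t)"
  have m: "m \<ge> 2" "length es = m" "distinct es" "set es = C"
    and joins: "\<And>t. t < m \<Longrightarrow> joins (es ! t) (vs ! t) (vs ! ((t + 1) mod m))"
    using w by (auto simp: circle_walk_def m_def)
  obtain s where s: "s < m" "es ! s = e"
    using e m by (auto simp: in_set_conv_nth)
  have sat_iff: "satisfies q x (es ! t) \<longleftrightarrow> q dvd d t" if "t < m" for t
    using satisfies_iff_gain_dir[OF joins[OF that]] by (simp add: d_def g_def)
  have rest: "q dvd (\<Sum>t\<in>{..<m} - {s}. d t)"
  proof (rule dvd_sum)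
    fix t assume t: "t \<in> {..<m} - {s}"
    then have "es ! t \<in> C - {e}"
      using m s nth_eq_iff_index_eq[of es t s] nth_mem[of t es] by auto
    then show "q dvd d t"
      using sat sat_iff t by blast
  qed
  have "(\<Sum>t<m. d t) = (\<Sum>t<m. x (vs ! ((t + 1) mod m))) - (\<Sum>t<m. x (vs ! t)) - (\<Sum>t<m. g t)"
    by (simp add: d_def sum_subtractf)
  also have "\<dots> = - (\<Sum>t<m. g t)"
    using sum_rotate[of m "\<lambda>t. x (vs ! t)"] m by simp
  finally have "- (\<Sum>t<m. g t) = d s + (\<Sum>t\<in>{..<m} - {s}. d t)"
    using s by (simp add: sum.remove)
  then have "q dvd - (\<Sum>t<m. g t) \<longleftrightarrow> q dvd d s"
    using rest by (simp add: dvd_add_left_iff)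
  then show ?thesis
    using sat_iff[OF s(1)] s by (simp add: g_def m_def)
qed

lemma balanced_circle_satisfies:
  assumes "balanced_circle C" "e \<in> C" "\<And>f. f \<in> C - {e} \<Longrightarrow> satisfies q x f"
  shows "satisfies q x e"
proof -
  obtain vs es where w: "circle_walk C vs es"
    and "(\<Sum>t<length vs. gain_dir (es ! t) (vs ! t) (vs ! ((t + 1) mod length vs))) = 0"
    using assms(1) by (auto simp: balanced_circle_def)
  then show ?thesis
    using circle_satisfies_iff[OF w assms(2,3)] by simp
qed

text \<open>A circle has at most \<open>n\<close> edges with gains in {-1, 0, 1}, so its gain sum is
  smaller than \<open>q\<close> in absolute value. Being divisible by \<open>q\<close>, the sum is
  0.\<close>

lemma satisfied_circle_balanced:
  assumes "is_circle C" "C \<subseteq> shi_edges n" "q > int n" and sat: "\<And>f. f \<in> C \<Longrightarrow> satisfies q x f"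
  shows "balanced_circle C"
proof -
  obtain vs es where w: "circle_walk C vs es"
    using assms(1) by (auto simp: is_circle_def)
  define m where "m = length vs"
  have m: "m \<ge> 2" "length es = m" "set es = C" "distinct vs"
    and joins: "\<And>t. t < m \<Longrightarrow> joins (es ! t) (vs ! t) (vs ! ((t + 1) mod m))"
    using w by (auto simp: circle_walk_def m_def)
  have edge: "es ! t \<in> shi_edges n" if "t < m" for t
    using that m assms(2) nth_mem by fastforce
  let ?G = "\<Sum>t<m. gain_dir (es ! t) (vs ! t) (vs ! ((t + 1) mod m))"
  have "vs ! t \<in> {1..n}" if "t < m" for t
    using shi_edgeD(1,2)[OF edge[OF that]] joins[OF that] by (auto simp: joins_def)
  then have "set vs \<subseteq> {1..n}"
    by (auto simp: in_set_conv_nth m_def)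
  then have "m \<le> n"
    using card_mono[of "{1..n}" "set vs"] m by (simp add: distinct_card m_def)
  have "\<bar>?G\<bar> \<le> (\<Sum>t<m. \<bar>gain_dir (es ! t) (vs ! t) (vs ! ((t + 1) mod m))\<bar>)"
    by (rule sum_abs)
  also have "\<dots> \<le> (\<Sum>t<m. 1)"
    using edge by (intro sum_mono) (fastforce simp: gain_dir_def shi_edges_def)
  also have "\<dots> < q"
    using \<open>m \<le> n\<close> assms(3) by simp
  finally have "\<bar>?G\<bar> < q" .
  moreover have "es ! 0 \<in> C"
    using m nth_mem[of 0 es] by auto
  then have "q dvd ?G"
    using circle_satisfies_iff[OF w, of "es ! 0" q x] sat by (simp add: m_def)
  ultimately have "?G = 0"
    using int_dvd_small_iff by blast
  then show ?thesis
    using w by (auto simp: balanced_circle_def m_def)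
qed

lemma satisfies_shift_on:
  assumes "f \<in> shi_edges n" "fst f \<in> K \<longleftrightarrow> fst (snd f) \<in> K"
  shows "satisfies q (shift_on n q K c x) f \<longleftrightarrow> satisfies q x f"
proof -
  have "x (fst (snd f)) + c - (x (fst f) + c) - snd (snd f) = x (fst (snd f)) - x (fst f) - snd (snd f)"
    by simp
  then show ?thesis
    using shi_edgeD[OF assms(1)] assms(2)
    by (auto simp: satisfies_def shift_on_def dvd_mod_diff_iff)
qed

text \<open>Let \<open>K\<close> be the component of the end \<open>v\<close> of \<open>e\<close> in
  \<open>S\<close>; the other end lies outside. Shifting \<open>K\<close> by \<open>c\<close>
  preserves the equations of \<open>S\<close> and moves the defect of \<open>e\<close> by
  \<open>c\<close>, so each potential of \<open>S\<close> is in a unique way a shifted potential of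
  \<open>insert e S\<close>.\<close>

lemma card_potentials_insert:
  assumes q: "q > 0" and S: "insert e S \<subseteq> shi_edges n" and e: "\<not> linked S e"
  shows "card (potentials n q S) = nat q * card (potentials n q (insert e S))"
proof -
  define u v g where "u = fst e" and "v = fst (snd e)" and "g = snd (snd e)"
  have uv: "u \<in> {1..n}" "v \<in> {1..n}"
    using shi_edgeD[of e n] S by (auto simp: u_def v_def)
  define K where "K = {w. (v, w) \<in> (link S)\<^sup>*}"
  have K: "v \<in> K" "u \<notin> K"
    using e link_rtrancl_commute by (auto simp: K_def u_def v_def linked_def)
  have closed: "fst f \<in> K \<longleftrightarrow> fst (snd f) \<in> K" if "f \<in> S" for f
  proof -
    have "(fst f, fst (snd f)) \<in> (link S)\<^sup>*" "(fst (snd f), fst f) \<in> (link S)\<^sup>*"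
      using linked_member[OF that] link_rtrancl_commute by (auto simp: linked_def)
    then show ?thesis
      unfolding K_def mem_Collect_eq by (meson rtrancl_trans)
  qed
  have in_S: "shift_on n q K c x \<in> potentials n q S" if "x \<in> potentials n q S" for c x
    unfolding potentials_def
  proof (intro CollectI conjI ballI)
    show "shift_on n q K c x \<in> {1..n} \<rightarrow>\<^sub>E {0..<q}"
      using that by (intro shift_on_PiE[OF q]) (simp add: potentials_def)
    fix f assume f: "f \<in> S"
    then have "satisfies q x f"
      using that by (simp add: potentials_def)
    then show "satisfies q (shift_on n q K c x) f"
      using satisfies_shift_on[OF _ closed[OF f]] f S by blast
  qed
  have diff: "(shift_on n q K c x v - shift_on n q K c x u - g) mod q = (x v - x u - g + c) mod q" for c x
  proof -
    have "((x v + c) mod q - (x u + g)) mod q = (x v + c - (x u + g)) mod q"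
      by (rule mod_diff_left_eq)
    then show ?thesis
      using K uv by (simp add: shift_on_def diff_diff_eq add.commute)
        (simp add: diff_diff_eq[symmetric] add_diff_eq)
  qed
  have sat_e: "satisfies q x e \<longleftrightarrow> (x v - x u - g) mod q = 0" for x
    by (simp add: satisfies_def u_def v_def g_def dvd_eq_mod_eq_0)
  \<comment> \<open>The defect of \<open>e\<close> at \<open>y\<close>, hence the shift that has to
    be undone.\<close>
  define pos where "pos = (\<lambda>y. (y v - y u - g) mod q)"
  have "bij_betw (\<lambda>(x, c). shift_on n q K c x) (potentials n q (insert e S) \<times> {0..<q}) (potentials n q S)"
  proof (rule bij_betw_byWitness[where f' = "\<lambda>y. (shift_on n q K (- pos y) y, pos y)"]; intro ballI subsetI)
    fix z assume "z \<in> potentials n q (insert e S) \<times> {0..<q}"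
    then obtain x c where z: "z = (x, c)" "x \<in> potentials n q (insert e S)" "c \<in> {0..<q}"
      by auto
    then have "satisfies q x e" and x: "x \<in> {1..n} \<rightarrow>\<^sub>E {0..<q}"
      by (auto simp: potentials_def)
    then have "(x v - x u - g) mod q = 0"
      by (simp add: sat_e)
    then have "(x v - x u - g + c) mod q = c mod q"
      by (metis add_0 mod_add_left_eq)
    then have "pos (shift_on n q K c x) = c"
      using z(3) unfolding pos_def diff by simp
    moreover have "shift_on n q K (- c) (shift_on n q K c x) = x"
      using x by (intro shift_on_shift_on) simp_all
    ultimately show "(\<lambda>y. (shift_on n q K (- pos y) y, pos y)) ((\<lambda>(x, c). shift_on n q K c x) z) = z"
      using z by simp
  next
    fix y assume "y \<in> potentials n q S"
    then have "y \<in> {1..n} \<rightarrow>\<^sub>E {0..<q}"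
      by (simp add: potentials_def)
    then show "(\<lambda>(x, c). shift_on n q K c x) (shift_on n q K (- pos y) y, pos y) = y"
      using shift_on_shift_on by simp
  next
    fix y assume "y \<in> (\<lambda>(x, c). shift_on n q K c x) ` (potentials n q (insert e S) \<times> {0..<q})"
    then show "y \<in> potentials n q S"
      using in_S by (auto simp: potentials_def)
  next
    fix z assume "z \<in> (\<lambda>y. (shift_on n q K (- pos y) y, pos y)) ` potentials n q S"
    then obtain y where y: "y \<in> potentials n q S" "z = (shift_on n q K (- pos y) y, pos y)"
      by auto
    have "(y v - y u - g + - pos y) mod q = 0"
      unfolding pos_def by (simp add: mod_diff_right_eq)
    then have "satisfies q (shift_on n q K (- pos y) y) e"
      unfolding sat_e diff .
    with in_S[OF y(1), of "- pos y"] have "shift_on n q K (- pos y) y \<in> potentials n q (insert e S)"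
      by (simp add: potentials_def)
    moreover have "pos y \<in> {0..<q}"
      using q by (simp add: pos_def)
    ultimately show "z \<in> potentials n q (insert e S) \<times> {0..<q}"
      using y by simp
  qed
  then have "card (potentials n q S) = card (potentials n q (insert e S) \<times> {0..<q})"
    by (simp add: bij_betw_same_card)
  then show ?thesis
    by (simp add: card_cartesian_product)
qed

lemma card_potentials_forest:
  assumes q: "q > 0" and "is_forest S" "S \<subseteq> shi_edges n"
  shows "card (potentials n q S) * nat q ^ card S = nat q ^ n"
proof -
  have "finite S"
    using assms(3) finite_subset by fastforce
  then show ?thesis
    using assms(2,3)
  proof (induction S rule: finite_induct)
    case empty
    have "potentials n q {} = {1..n} \<rightarrow>\<^sub>E {0..<q}"
      by (simp add: potentials_def)
    then show ?case
      by (simp add: card_PiE)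
  next
    case (insert e S)
    have "is_forest S"
      using insert.prems(1) is_forest_subset by blast
    moreover have "\<not> linked S e"
      using forest_not_linked[OF insert.prems, of e] insert.hyps by simp
    ultimately show ?case
      using insert card_potentials_insert[OF q insert.prems(2)] by (simp add: mult.assoc mult.left_commute)
  qed
qed

text \<open>The value at vertex 1 determines all others along paths of \<open>B\<close>, and every
  value occurs there by rotating one existing potential.\<close>

lemma card_potentials_spanning_tree:
  assumes q: "q > 0" and B: "spanning_tree n B" and n: "n \<ge> 1"
  shows "card (potentials n q B) = nat q"
proof -
  have BE: "B \<subseteq> shi_edges n" and forB: "is_forest B" and conB: "connected_on n B"
    using B by (auto simp: spanning_tree_def)
  have one: "1 \<in> {1..n}"
    using n by simp
  have "bij_betw (\<lambda>x. x 1) (potentials n q B) {0..<q}"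
    unfolding bij_betw_def
  proof
    show "inj_on (\<lambda>x. x 1) (potentials n q B)"
    proof (rule inj_onI)
      fix x y assume xy: "x \<in> potentials n q B" "y \<in> potentials n q B" "x 1 = y 1"
      have "q dvd x v - y v" if "(1, v) \<in> (link B)\<^sup>*" for v
        using that
      proof (induction rule: rtrancl_induct)
        case base
        show ?case
          using xy by simp
      next
        case (step v w)
        then obtain e where e: "e \<in> B" "joins e v w"
          by (auto simp: link_def)
        then have "q dvd x w - x v - gain_dir e v w" "q dvd y w - y v - gain_dir e v w"
          using xy satisfies_iff_gain_dir[OF e(2)] by (auto simp: potentials_def)
        then have "q dvd (x w - x v - gain_dir e v w) - (y w - y v - gain_dir e v w) + (x v - y v)"
          using dvd_add[OF dvd_diff step.IH] by blast
        then show ?case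
          by (simp add: algebra_simps)
      qed
      then have dvd: "q dvd x v - y v" if "v \<in> {1..n}" for v
        using conB one that unfolding connected_on_iff by blast
      show "x = y"
      proof (rule extensionalityI[of _ "{1..n}"])
        fix v assume v: "v \<in> {1..n}"
        then have "x v \<in> {0..<q}" "y v \<in> {0..<q}"
          using xy unfolding potentials_def by blast+
        then have "\<bar>x v - y v\<bar> < q"
          by auto
        then show "x v = y v"
          using dvd[OF v] int_dvd_small_iff by fastforce
      qed (use xy in \<open>auto simp: potentials_def PiE_def\<close>)
    qed
  next
    show "(\<lambda>x. x 1) ` potentials n q B = {0..<q}"
    proof (intro equalityI subsetI)
      fix c assume "c \<in> (\<lambda>x. x 1) ` potentials n q B"
      then show "c \<in> {0..<q}"
        using one unfolding potentials_def by blast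
    next
      fix c assume c: "c \<in> {0..<q}"
      have "card (potentials n q B) \<noteq> 0"
        using card_potentials_forest[OF q forB BE] q by (metis mult_0 power_eq_0_iff zero_less_nat_eq less_irrefl)
      then obtain x where x: "x \<in> potentials n q B"
        by fastforce
      let ?y = "shift_on n q UNIV (c - x 1) x"
      have "?y \<in> potentials n q B"
        using x shift_on_PiE[OF q, of x n UNIV "c - x 1"] satisfies_shift_on[of _ n UNIV q "c - x 1" x] BE
        unfolding potentials_def by blast
      moreover have "?y 1 = c"
        using one c by (simp add: shift_on_def)
      ultimately show "c \<in> (\<lambda>x. x 1) ` potentials n q B"
        by (metis image_eqI)
    qed
  qed
  then show ?thesis
    by (simp add: bij_betw_same_card)
qed

text \<open>The two counts of potentials, compared at \<open>q = 2\<close>, give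
  \<open>2 ^ Suc (card B) = 2 ^ n\<close>.\<close>

lemma card_spanning_tree:
  assumes B: "spanning_tree n B" and n: "n \<ge> 1"
  shows "card B = n - 1"
proof -
  have "card (potentials n 2 B) * nat 2 ^ card B = nat 2 ^ n"
    using B by (intro card_potentials_forest) (auto simp: spanning_tree_def)
  then have "(2::nat) ^ Suc (card B) = 2 ^ n"
    using card_potentials_spanning_tree[OF _ B n, of 2] by simp
  then have "Suc (card B) = n"
    using power_inject_exp[of "2::nat"] by (metis one_less_numeral_iff semiring_norm(76))
  then show ?thesis
    by simp
qed

section \<open>Greedy completion and activity\<close>

text \<open>\<open>rank\<close> represents the order \<open>R\<close> on the edges by numbers, so
  that maxima and induction on the rank are available.\<close>

locale ranked_shi =
  fixes n :: nat and R :: "gedge rel" and rank :: "gedge \<Rightarrow> nat"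
  assumes n_ge: "n \<ge> 1"
    and inj_rank: "inj_on rank (shi_edges n)"
    and rank_le: "\<And>e f. e \<in> shi_edges n \<Longrightarrow> f \<in> shi_edges n \<Longrightarrow> (e, f) \<in> R \<longleftrightarrow> rank e \<le> rank f"
begin

text \<open>The missing edges of the broken circuits contained in \<open>S\<close>. Whether
  \<open>e\<close> is a candidate does not depend on whether \<open>e\<close> itself lies in
  \<open>S\<close>, which allows toggling it.\<close>

definition candidates :: "gedge set \<Rightarrow> gedge set" where
  "candidates S = {e. \<exists>C. C \<subseteq> shi_edges n \<and> balanced_circle C \<and> is_min_in R C e \<and> C - {e} \<subseteq> S}"

lemma nbc_set_iff: "nbc_set n R S \<longleftrightarrow> S \<subseteq> shi_edges n \<and> is_forest S \<and> candidates S = {}"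
  unfolding nbc_set_def broken_circuit_def candidates_def by blast

lemma candidates_mono: "S \<subseteq> T \<Longrightarrow> candidates S \<subseteq> candidates T"
  unfolding candidates_def by blast

lemma nbc_set_subset: "nbc_set n R S \<Longrightarrow> T \<subseteq> S \<Longrightarrow> nbc_set n R T"
  unfolding nbc_set_iff using is_forest_subset candidates_mono by blast

text \<open>Kruskal's rule started from \<open>S\<close>: in order of increasing rank, an edge is
  added unless \<open>S\<close> and the smaller edges already link its ends.\<close>

definition greedy :: "gedge set \<Rightarrow> gedge set" where
  "greedy S = {e \<in> shi_edges n. \<not> linked (S \<union> {f \<in> shi_edges n. rank f < rank e}) e}"

lemma greedy_subset: "greedy S \<subseteq> shi_edges n"
  by (auto simp: greedy_def)

lemma greedy_disjoint: "S \<inter> greedy S = {}"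
  using linked_member by (auto simp: greedy_def)

text \<open>An edge that is not added is linked by \<open>S\<close> and smaller edges, and by
  induction these are linked by \<open>S\<close> and added edges of no larger rank.\<close>

lemma linked_greedy:
  assumes "f \<in> shi_edges n"
  shows "linked (S \<union> {g \<in> greedy S. rank g \<le> rank f}) f"
  using assms
proof (induction "rank f" arbitrary: f rule: less_induct)
  case less
  show ?case
  proof (cases "f \<in> greedy S")
    case True
    then show ?thesis
      by (intro linked_member) simp
  next
    case False
    then have "linked (S \<union> {g \<in> shi_edges n. rank g < rank f}) f"
      using less.prems by (simp add: greedy_def)
    then show ?thesis
    proof (rule linked_subst)
      fix g assume "g \<in> S \<union> {g \<in> shi_edges n. rank g < rank f}"
      then consider "g \<in> S" | "g \<in> shi_edges n" "rank g < rank f"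
        by blast
      then show "linked (S \<union> {g \<in> greedy S. rank g \<le> rank f}) g"
      proof cases
        case 1
        then show ?thesis
          by (intro linked_member) simp
      next
        case 2
        from less.hyps[OF this(2,1)] show ?thesis
          by (rule linked_mono) (use 2 in auto)
      qed
    qed
  qed
qed

lemma connected_greedy: "connected_on n (S \<union> greedy S)"
  by (rule connected_onI, rule linked_mono[OF linked_greedy[of _ S]]) auto

text \<open>If \<open>f\<close> had the top rank in \<open>C - S\<close>, the rest of
  \<open>C\<close> would link it using only \<open>S\<close> and smaller edges.\<close>

lemma circle_greedy_not_max:
  assumes "is_circle C" "C \<subseteq> shi_edges n" "f \<in> C" "f \<in> greedy S"
  shows "\<exists>g\<in>C - S. rank f < rank g"
proof (rule ccontr)
  assume neg: "\<not> ?thesis"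
  have "C - {f} \<subseteq> S \<union> {g \<in> shi_edges n. rank g < rank f}"
  proof
    fix g assume g: "g \<in> C - {f}"
    then have "rank g \<noteq> rank f"
      using inj_onD[OF inj_rank, of g f] assms by blast
    moreover have "g \<in> S \<or> rank g \<le> rank f"
      using g neg linorder_not_less by blast
    ultimately show "g \<in> S \<union> {g \<in> shi_edges n. rank g < rank f}"
      using g assms(2) by auto
  qed
  moreover have "linked (C - {f}) f"
    using assms circle_walk_linked unfolding is_circle_def by blast
  ultimately show False
    using assms(4) linked_mono by (auto simp: greedy_def)
qed

lemma forest_greedy:
  assumes "is_forest S" "S \<subseteq> shi_edges n"
  shows "is_forest (S \<union> greedy S)"
  unfolding is_forest_def
proof (intro allI impI notI)
  fix C assume C: "C \<subseteq> S \<union> greedy S" "is_circle C"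
  then have CE: "C \<subseteq> shi_edges n"
    using assms greedy_subset by blast
  then have fin: "finite (C \<inter> greedy S)"
    using finite_subset by fastforce
  moreover have "C \<inter> greedy S \<noteq> {}"
    using C assms unfolding is_forest_def by blast
  \<comment> \<open>The largest added edge on the circle is outranked by an edge outside
    \<open>S\<close>, which is again an added one.\<close>
  ultimately obtain f where f: "f \<in> C \<inter> greedy S" "\<And>g. g \<in> C \<inter> greedy S \<Longrightarrow> rank g \<le> rank f"
    using obtains_MAX[of "C \<inter> greedy S" rank] by (metis Max_ge finite_imageI imageI)
  obtain g where "g \<in> C - S" "rank f < rank g"
    using circle_greedy_not_max[OF C(2) CE, of f S] f by blast
  then show False
    using C f(2)[of g] by auto
qed

text \<open>A broken circuit in the completion but not in \<open>S\<close> has a largest added edge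
  \<open>f\<close>. Some edge of the circle outside \<open>S\<close> outranks \<open>f\<close>; it
  is not the missing smallest edge, so it was added too, against the choice of
  \<open>f\<close>.\<close>

lemma nbc_basis_greedy:
  assumes S: "nbc_set n R S"
  shows "nbc_basis n R (S \<union> greedy S)"
proof -
  have SE: "S \<subseteq> shi_edges n" and forS: "is_forest S" and candS: "candidates S = {}"
    using S by (auto simp: nbc_set_iff)
  have "candidates (S \<union> greedy S) = {}"
  proof (rule equals0I)
    fix e assume "e \<in> candidates (S \<union> greedy S)"
    then obtain C where C: "C \<subseteq> shi_edges n" "balanced_circle C" "is_min_in R C e" "C - {e} \<subseteq> S \<union> greedy S"
      by (auto simp: candidates_def)
    have eC: "e \<in> C" and min: "\<And>f. f \<in> C \<Longrightarrow> rank e \<le> rank f"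
      using C(1,3) rank_le unfolding is_min_in_def by blast+
    have circ: "is_circle C"
      using C(2) by (auto simp: balanced_circle_def is_circle_def)
    have fin: "finite ((C - {e}) \<inter> greedy S)"
      using C(1) finite_subset by fastforce
    moreover have "(C - {e}) \<inter> greedy S \<noteq> {}"
      using candS C unfolding candidates_def by blast
    ultimately obtain f where f: "f \<in> (C - {e}) \<inter> greedy S"
      "\<And>g. g \<in> (C - {e}) \<inter> greedy S \<Longrightarrow> rank g \<le> rank f"
      using obtains_MAX[of "(C - {e}) \<inter> greedy S" rank] by (metis Max_ge finite_imageI imageI)
    obtain g where g: "g \<in> C - S" "rank f < rank g"
      using circle_greedy_not_max[OF circ C(1), of f S] f by blast
    then have "g \<noteq> e"
      using min[of f] f by auto
    then show False
      using C(4) f(2)[of g] g by auto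
  qed
  then show ?thesis
    using SE greedy_subset forest_greedy[OF forS SE] connected_greedy
    by (simp add: nbc_basis_def nbc_set_iff spanning_tree_def)
qed

text \<open>An edge \<open>f\<close> smaller than \<open>e\<close> is linked by \<open>S\<close> and
  added edges of rank at most that of \<open>f\<close>, so by the basis without \<open>e\<close>.
  Hence \<open>f\<close> cannot replace \<open>e\<close>.\<close>

lemma greedy_active:
  assumes S: "nbc_set n R S" and e: "e \<in> greedy S"
  shows "active_edge n R (S \<union> greedy S) e"
  unfolding active_edge_def is_min_in_def
proof (intro conjI CollectI ballI)
  let ?B = "S \<union> greedy S"
  have B: "spanning_tree n ?B"
    using nbc_basis_greedy[OF S] by (simp add: nbc_basis_def)
  then have BE: "?B \<subseteq> shi_edges n" and forB: "is_forest ?B"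
    by (auto simp: spanning_tree_def)
  show "e \<in> ?B" and eE: "e \<in> shi_edges n"
    using e greedy_subset by auto
  then have "?B - {e} \<union> {e} = ?B"
    by blast
  then show "spanning_tree n (?B - {e} \<union> {e})"
    using B by simp
  fix f assume "f \<in> {f \<in> shi_edges n. spanning_tree n (?B - {e} \<union> {f})}"
  then have f: "f \<in> shi_edges n" "is_forest (insert f (?B - {e}))" "connected_on n (insert f (?B - {e}))"
    "insert f (?B - {e}) \<subseteq> shi_edges n"
    by (auto simp: spanning_tree_def)
  have "rank e \<le> rank f"
  proof (rule ccontr)
    assume less: "\<not> rank e \<le> rank f"
    have "e \<notin> S"
      using greedy_disjoint e by blast
    then have linked: "linked (?B - {e}) f"
      using less by (intro linked_mono[OF linked_greedy[OF f(1), of S]]) auto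
    \<comment> \<open>If \<open>f\<close> is already in the basis, the exchange merely drops
      \<open>e\<close> and disconnects; otherwise it closes a circle.\<close>
    show False
    proof (cases "f \<in> ?B - {e}")
      case True
      then have "linked (?B - {e}) e"
        using connected_linked[OF f(3) eE] by (simp add: insert_absorb)
      then show False
        using forest_not_linked[OF forB BE \<open>e \<in> ?B\<close>] by blast
    next
      case False
      then show False
        using forest_not_linked[OF f(2,4), of f] linked by simp
    qed
  qed
  then show "(e, f) \<in> R"
    using rank_le eE f(1) by blast
qed

text \<open>If \<open>e\<close> in \<open>A\<close> were not greedy, some edge of
  \<open>B - A\<close> or of smaller rank would not be linked by \<open>B - {e}\<close>. It is not
  in \<open>B - A\<close>, so it is smaller than \<open>e\<close> and can replace \<open>e\<close>,
  contradicting activity.\<close>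

lemma active_subset_greedy:
  assumes B: "spanning_tree n B" and A: "A \<subseteq> {e \<in> B. active_edge n R B e}"
  shows "A \<subseteq> greedy (B - A)"
proof
  have BE: "B \<subseteq> shi_edges n" and forB: "is_forest B"
    using B by (auto simp: spanning_tree_def)
  fix e assume e: "e \<in> A"
  then have eB: "e \<in> B" and act: "active_edge n R B e"
    using A by auto
  show "e \<in> greedy (B - A)"
  proof (rule ccontr)
    assume "e \<notin> greedy (B - A)"
    then have linked: "linked (B - A \<union> {f \<in> shi_edges n. rank f < rank e}) e"
      using eB BE by (auto simp: greedy_def)
    obtain f where f: "f \<in> B - A \<union> {f \<in> shi_edges n. rank f < rank e}" "\<not> linked (B - {e}) f"
      using linked_subst[OF linked, of "B - {e}"] forest_not_linked[OF forB BE eB] by blast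
    have "f \<notin> B - A"
      using f(2) linked_member[of f "B - {e}"] e by blast
    with f have f': "f \<in> shi_edges n" "rank f < rank e"
      by auto
    then have "spanning_tree n (B - {e} \<union> {f})"
      using spanning_tree_exchange[OF B eB _ f(2)] by blast
    then have "(e, f) \<in> R"
      using act f' unfolding active_edge_def is_min_in_def by blast
    then show False
      using rank_le[of e f] f' eB BE by auto
  qed
qed

text \<open>A further greedy edge would close a circle with the spanning tree \<open>B\<close>,
  while the greedy completion of \<open>B - A\<close> is a forest.\<close>

lemma greedy_remove_active:
  assumes B: "spanning_tree n B" and A: "A \<subseteq> {e \<in> B. active_edge n R B e}"
  shows "greedy (B - A) = A"
proof (intro equalityI subsetI)
  have BE: "B \<subseteq> shi_edges n" and forB: "is_forest B" and conB: "connected_on n B"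
    using B by (auto simp: spanning_tree_def)
  fix e assume e: "e \<in> greedy (B - A)"
  show "e \<in> A"
  proof (rule ccontr)
    assume "e \<notin> A"
    then have "e \<notin> B"
      using e greedy_disjoint[of "B - A"] by blast
    have eE: "e \<in> shi_edges n"
      using e greedy_subset by blast
    have "B \<subseteq> (B - A) \<union> greedy (B - A) - {e}"
      using active_subset_greedy[OF assms] \<open>e \<notin> B\<close> by blast
    then have "linked ((B - A) \<union> greedy (B - A) - {e}) e"
      using connected_linked[OF conB eE] linked_mono by blast
    moreover have "is_forest ((B - A) \<union> greedy (B - A))"
      using forest_greedy[of "B - A"] is_forest_subset[OF forB, of "B - A"] BE by blast
    moreover have "(B - A) \<union> greedy (B - A) \<subseteq> shi_edges n"
      using BE greedy_subset by blast
    ultimately show False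
      using forest_not_linked e by blast
  qed
qed (use active_subset_greedy[OF assms] in blast)

end

section \<open>Broken circuits\<close>

lemma sum_Pow_alternating:
  assumes "finite P"
  shows "(\<Sum>S\<in>Pow P. (-1) ^ card S) = (if P = {} then 1 else 0 :: int)"
  using sum_Pow_power[OF assms, of "-1" "1::int"] assms by (simp add: power_0_left)

text \<open>Inclusion-exclusion: a point contributes the alternating sum over the subsets of the
  edges it satisfies, which vanishes unless there are none.\<close>

lemma sum_potentials_eq_card_shi_colorings:
  "(\<Sum>S\<in>Pow (shi_edges n). (-1) ^ card S * int (card (potentials n q S))) = int (card (shi_colorings n q))"
proof -
  define X where "X = ({1..n} \<rightarrow>\<^sub>E {0..<q} :: (nat \<Rightarrow> int) set)"
  define Ex where "Ex = (\<lambda>x. {e \<in> shi_edges n. satisfies q x e})"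
  have finX: "finite X"
    by (auto simp: X_def intro: finite_PiE)
  have finE: "finite (Ex x)" for x
    by (simp add: Ex_def)
  have "(\<Sum>S\<in>Pow (shi_edges n). (-1) ^ card S * int (card (potentials n q S))) =
      (\<Sum>S\<in>Pow (shi_edges n). \<Sum>x | x \<in> X \<and> S \<subseteq> Ex x. (-1) ^ card S)"
  proof (intro sum.cong refl)
    fix S assume "S \<in> Pow (shi_edges n)"
    then have "potentials n q S = {x \<in> X. S \<subseteq> Ex x}"
      by (auto simp: potentials_def X_def Ex_def)
    then show "(-1) ^ card S * int (card (potentials n q S)) = (\<Sum>x | x \<in> X \<and> S \<subseteq> Ex x. (-1) ^ card S)"
      by simp
  qed
  also have "\<dots> = (\<Sum>x\<in>X. \<Sum>S | S \<in> Pow (shi_edges n) \<and> S \<subseteq> Ex x. (-1) ^ card S)"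
    using finX by (intro sum.swap_restrict) auto
  also have "\<dots> = (\<Sum>x\<in>X. \<Sum>S\<in>Pow (Ex x). (-1) ^ card S)"
    by (intro sum.cong refl) (auto simp: Ex_def)
  also have "\<dots> = (\<Sum>x\<in>X. if Ex x = {} then 1 else 0)"
    using sum_Pow_alternating[OF finE] by simp
  also have "\<dots> = int (card {x \<in> X. Ex x = {}})"
    using finX by (simp add: sum.If_cases Int_def)
  also have "{x \<in> X. Ex x = {}} = shi_colorings n q"
  proof -
    have "Ex x = {} \<longleftrightarrow> (\<forall>i\<in>{1..n}. \<forall>j\<in>{1..n}. i < j \<longrightarrow> \<not> q dvd x j - x i \<and> \<not> q dvd x j - x i - 1)" for x
      unfolding Ex_def shi_edges_def satisfies_def by fastforce
    then show ?thesis
      by (simp add: X_def shi_colorings_def)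
  qed
  finally show ?thesis .
qed

section \<open>Whitney's cancellation by a sign-reversing involution\<close>

context ranked_shi
begin

lemma finite_candidates: "finite (candidates S)" "candidates S \<subseteq> shi_edges n"
proof -
  show "candidates S \<subseteq> shi_edges n"
    by (auto simp: candidates_def is_min_in_def)
  then show "finite (candidates S)"
    using finite_subset by fastforce
qed

text \<open>The maximal rank is pulled back through the injective \<open>rank\<close>. The value is
  meaningful only when there are candidates.\<close>

definition top_candidate :: "gedge set \<Rightarrow> gedge" where
  "top_candidate S = inv_into (shi_edges n) rank (Max (rank ` candidates S))"

definition toggle :: "gedge set \<Rightarrow> gedge set" where
  "toggle S = (if top_candidate S \<in> S then S - {top_candidate S} else insert (top_candidate S) S)"

lemma top_candidate_eqI:
  assumes "e \<in> candidates S" "\<And>f. f \<in> candidates S \<Longrightarrow> rank f \<le> rank e"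
  shows "top_candidate S = e"
proof -
  have "Max (rank ` candidates S) = rank e"
    using assms finite_candidates(1) by (intro Max_eqI) auto
  then show ?thesis
    using assms(1)
    by (simp add: top_candidate_def inv_into_f_f[OF inj_rank] finite_candidates(2)[THEN subsetD])
qed

lemma top_candidate_in:
  assumes "candidates S \<noteq> {}"
  shows "top_candidate S \<in> candidates S" "f \<in> candidates S \<Longrightarrow> rank f \<le> rank (top_candidate S)"
proof -
  obtain e where "e \<in> candidates S" "\<And>f. f \<in> candidates S \<Longrightarrow> rank f \<le> rank e"
    using obtains_MAX[OF finite_candidates(1) assms, of rank]
    by (metis Max_ge finite_candidates(1) finite_imageI imageI)
  then show "top_candidate S \<in> candidates S" "f \<in> candidates S \<Longrightarrow> rank f \<le> rank (top_candidate S)"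
    using top_candidate_eqI by auto
qed

text \<open>A broken circuit whose missing edge ranks at least as high as the top candidate does not contain
  the latter, so toggling it does not change the candidates from there on.\<close>
lemma top_candidate_toggle:
  assumes ne: "candidates S \<noteq> {}"
  shows "candidates (toggle S) \<noteq> {}" "top_candidate (toggle S) = top_candidate S"
proof -
  let ?e = "top_candidate S"
  have same: "toggle S - {?e} = S - {?e}"
    by (auto simp: toggle_def)
  obtain C where "C \<subseteq> shi_edges n" "balanced_circle C" "is_min_in R C ?e" "C - {?e} \<subseteq> S"
    using top_candidate_in(1)[OF ne] by (auto simp: candidates_def)
  moreover from this have "C - {?e} \<subseteq> toggle S"
    using same by blast
  ultimately have e: "?e \<in> candidates (toggle S)"
    by (auto simp: candidates_def)
  then show "candidates (toggle S) \<noteq> {}"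
    by blast
  show "top_candidate (toggle S) = ?e"
  proof (rule top_candidate_eqI[OF e], rule ccontr)
    fix f assume "f \<in> candidates (toggle S)" and less: "\<not> rank f \<le> rank ?e"
    then obtain D where D: "D \<subseteq> shi_edges n" "balanced_circle D" "is_min_in R D f" "D - {f} \<subseteq> toggle S"
      by (auto simp: candidates_def)
    have "?e \<notin> D"
      using D(1,3) less rank_le[of f ?e] unfolding is_min_in_def by blast
    then have "D - {f} \<subseteq> S"
      using D(4) same by blast
    then have "f \<in> candidates S"
      using D by (auto simp: candidates_def)
    then show False
      using top_candidate_in(2)[OF ne] less by blast
  qed
qed

lemma toggle_toggle: "candidates S \<noteq> {} \<Longrightarrow> toggle (toggle S) = S"
  using top_candidate_toggle(2) unfolding toggle_def[of "toggle S"] by (auto simp: toggle_def)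

text \<open>The top candidate completes edges of \<open>S\<close> to a balanced circle, so its
  equation follows from theirs.\<close>

lemma potentials_toggle:
  assumes ne: "candidates S \<noteq> {}"
  shows "potentials n q (toggle S) = potentials n q S"
proof -
  let ?e = "top_candidate S"
  obtain C where C: "balanced_circle C" "?e \<in> C" "C - {?e} \<subseteq> S"
    using top_candidate_in(1)[OF ne] by (auto simp: candidates_def is_min_in_def)
  have insert: "potentials n q T = potentials n q (insert ?e T)" if "T - {?e} = S - {?e}" for T
  proof -
    have "satisfies q x ?e" if "\<forall>f\<in>T. satisfies q x f" for x
      using balanced_circle_satisfies[OF C(1,2)] C(3) that \<open>T - {?e} = S - {?e}\<close> by blast
    then show ?thesis
      unfolding potentials_def by blast
  qed
  have "toggle S - {?e} = S - {?e}" "insert ?e (toggle S) = insert ?e S"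
    by (auto simp: toggle_def)
  then show ?thesis
    using insert[of S] insert[of "toggle S"] by simp
qed

text \<open>Toggling changes the cardinality by one and keeps the potentials, so the sets containing
  a broken circuit cancel in the inclusion-exclusion sum.\<close>

lemma sum_nbc_sets:
  assumes q: "q > int n"
  shows "(\<Sum>S | nbc_set n R S. (-1) ^ card S * int (card (potentials n q S))) = q * (q - int n) ^ (n - 1)"
proof -
  define w where "w = (\<lambda>S. (-1) ^ card S * int (card (potentials n q S)))"
  define Bad where "Bad = {S \<in> Pow (shi_edges n). candidates S \<noteq> {}}"
  have "bij_betw toggle Bad Bad"
  proof (rule bij_betw_byWitness[where f' = toggle])
    have "toggle S \<subseteq> shi_edges n" if "S \<subseteq> shi_edges n" "candidates S \<noteq> {}" for S
      using that top_candidate_in(1) finite_candidates(2) by (auto simp: toggle_def)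
    then show "toggle ` Bad \<subseteq> Bad" "toggle ` Bad \<subseteq> Bad"
      using top_candidate_toggle(1) by (auto simp: Bad_def)
  qed (auto simp: Bad_def toggle_toggle)
  then have "(\<Sum>S\<in>Bad. w (toggle S)) = (\<Sum>S\<in>Bad. w S)"
    by (rule sum.reindex_bij_betw)
  moreover have "w (toggle S) = - w S" if "S \<in> Bad" for S
  proof -
    have "finite S"
      using that finite_subset by (fastforce simp: Bad_def)
    then have "(-1) ^ card (toggle S) = - ((-1) ^ card S :: int)"
      using card.remove[of S "top_candidate S"]
      by (cases "top_candidate S \<in> S") (simp_all add: toggle_def del: card_Diff_insert)
    then show ?thesis
      using that potentials_toggle by (simp add: w_def Bad_def)
  qed
  ultimately have "(\<Sum>S\<in>Bad. w S) = - (\<Sum>S\<in>Bad. w S)"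
    by (simp add: sum_negf)
  then have bad: "(\<Sum>S\<in>Bad. w S) = 0"
    by simp
  have "Bad \<subseteq> Pow (shi_edges n)"
    by (auto simp: Bad_def)
  have sub: "{S. nbc_set n R S} \<subseteq> Pow (shi_edges n) - Bad"
    by (auto simp: nbc_set_iff Bad_def)
  \<comment> \<open>A set outside \<open>Bad\<close> that is no forest contains a circle. The circle
    is unbalanced, as otherwise its smallest edge would be a candidate, and so for
    \<open>q > n\<close> the set has no potentials.\<close>
  have "(\<Sum>S | nbc_set n R S. w S) = (\<Sum>S\<in>Pow (shi_edges n) - Bad. w S)"
  proof (rule sum.mono_neutral_left[OF _ sub], simp, rule ballI)
    fix S assume S: "S \<in> Pow (shi_edges n) - Bad - {S. nbc_set n R S}"
    then have cand: "candidates S = {}" and SE: "S \<subseteq> shi_edges n" and "\<not> is_forest S"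
      by (auto simp: nbc_set_iff Bad_def)
    then obtain C where C: "C \<subseteq> S" "is_circle C"
      by (auto simp: is_forest_def)
    have "C \<noteq> {}"
      using C(2) by (auto simp: is_circle_def circle_walk_def)
    moreover have "finite C"
      using C(1) SE finite_subset by (metis finite_shi_edges)
    ultimately obtain e where e: "e \<in> C" "\<And>f. f \<in> C \<Longrightarrow> rank e \<le> rank f"
      using obtains_MIN[of C rank] by (metis Min_le finite_imageI imageI)
    then have "is_min_in R C e"
      using C(1) SE rank_le unfolding is_min_in_def by blast
    then have "\<not> balanced_circle C"
      using cand C(1) SE unfolding candidates_def by blast
    then have "potentials n q S = {}"
      using satisfied_circle_balanced[OF C(2) _ q] C(1) SE unfolding potentials_def by blast
    then show "w S = 0"
      by (simp add: w_def)
  qed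
  also have "\<dots> = (\<Sum>S\<in>Pow (shi_edges n). w S)"
    using sum.subset_diff[of Bad "Pow (shi_edges n)" w] bad \<open>Bad \<subseteq> Pow (shi_edges n)\<close> by simp
  also have "\<dots> = q * (q - int n) ^ (n - 1)"
    using sum_potentials_eq_card_shi_colorings[of n q] card_shi_colorings[OF n_ge q] by (simp add: w_def)
  finally show ?thesis
    by (simp add: w_def)
qed

section \<open>The generating function of activity\<close>

lemma card_nbc_set_le: "nbc_set n R S \<Longrightarrow> card S \<le> n - 1"
proof -
  assume S: "nbc_set n R S"
  then have B: "spanning_tree n (S \<union> greedy S)"
    using nbc_basis_greedy by (simp add: nbc_basis_def)
  then have "finite (S \<union> greedy S)"
    using finite_subset by (metis finite_shi_edges spanning_tree_def)
  then have "card S \<le> card (S \<union> greedy S)"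
    by (intro card_mono) auto
  then show "card S \<le> n - 1"
    using card_spanning_tree[OF B n_ge] by simp
qed

text \<open>An NBC set is a forest and has \<open>q ^ (n - card S)\<close> potentials; the factor
  \<open>(-1) ^ (n - 1) * q\<close> comes out of every term.\<close>

lemma sum_nbc_sets_power:
  assumes q: "q > int n"
  shows "(\<Sum>S | nbc_set n R S. (- q) ^ (n - 1 - card S)) = (int n - q) ^ (n - 1)"
proof -
  have "q > 0"
    using q by simp
  have "(-1) ^ card S * int (card (potentials n q S)) = (-1) ^ (n - 1) * q * (- q) ^ (n - 1 - card S)"
    if S: "nbc_set n R S" for S
  proof -
    define d where "d = n - 1 - card S"
    have n: "n = card S + Suc d"
      using card_nbc_set_le[OF S] n_ge by (simp add: d_def)
    have "card (potentials n q S) * nat q ^ card S = nat q ^ n"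
      using S \<open>q > 0\<close> by (intro card_potentials_forest) (auto simp: nbc_set_iff)
    also have "\<dots> = nat q ^ Suc d * nat q ^ card S"
      by (subst n) (simp only: power_add mult.commute)
    finally have "card (potentials n q S) = nat q ^ Suc d"
      using \<open>q > 0\<close> by simp
    then have "int (card (potentials n q S)) = q * q ^ d"
      using \<open>q > 0\<close> by simp
    moreover have "(-1) ^ (n - 1) = (-1) ^ card S * ((-1) ^ d :: int)"
      by (subst n) (simp add: power_add)
    moreover have "(-1) ^ d * (- q) ^ d = q ^ d"
      by (simp flip: power_mult_distrib)
    ultimately show ?thesis
      unfolding d_def[symmetric] by (simp add: mult.assoc mult.left_commute)
  qed
  then have "(\<Sum>S | nbc_set n R S. (-1) ^ card S * int (card (potentials n q S))) =
      (-1) ^ (n - 1) * q * (\<Sum>S | nbc_set n R S. (- q) ^ (n - 1 - card S))"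
    by (simp add: sum_distrib_left)
  then have "q * (q - int n) ^ (n - 1) = q * ((-1) ^ (n - 1) * (\<Sum>S | nbc_set n R S. (- q) ^ (n - 1 - card S)))"
    using sum_nbc_sets[OF q] by (simp add: mult.assoc mult.left_commute)
  then have "(q - int n) ^ (n - 1) = (-1) ^ (n - 1) * (\<Sum>S | nbc_set n R S. (- q) ^ (n - 1 - card S))"
    using \<open>q > 0\<close> by simp
  then have "(-1) ^ (n - 1) * (q - int n) ^ (n - 1) = (\<Sum>S | nbc_set n R S. (- q) ^ (n - 1 - card S))"
    by (simp flip: mult.assoc power_mult_distrib)
  moreover have "(-1) ^ (n - 1) * (q - int n) ^ (n - 1) = (int n - q) ^ (n - 1)"
    by (simp flip: power_mult_distrib)
  ultimately show ?thesis
    by simp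
qed

text \<open>The intervals from \<open>B\<close> without its active edges up to \<open>B\<close>, for \<open>B\<close> an NBC basis, partition
  the NBC sets.\<close>
lemma sum_nbc_bases_activity:
  fixes t :: "'a::comm_ring_1"
  shows "(\<Sum>B | nbc_basis n R B. (t + 1) ^ activity n R B) = (\<Sum>S | nbc_set n R S. t ^ (n - 1 - card S))"
proof -
  define Act where "Act = (\<lambda>B. {e \<in> B. active_edge n R B e})"
  have finB: "finite B" if "nbc_basis n R B" for B
    using that finite_subset by (metis finite_shi_edges nbc_basis_def spanning_tree_def)
  then have finA: "finite (Act B)" if "nbc_basis n R B" for B
    using that by (simp add: Act_def)
  have fin: "finite {B. nbc_basis n R B}"
    by (rule finite_subset[of _ "Pow (shi_edges n)"]) (auto simp: nbc_basis_def spanning_tree_def)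
  \<comment> \<open>The inverse sends \<open>S\<close> to its greedy completion paired with the
    added edges: these are active by \<open>greedy_active\<close>, and
    \<open>greedy_remove_active\<close> recovers \<open>A\<close> from \<open>B - A\<close>.\<close>
  have "bij_betw (\<lambda>(B, A). B - A) (SIGMA B:{B. nbc_basis n R B}. Pow (Act B)) {S. nbc_set n R S}"
  proof (rule bij_betw_byWitness[where f' = "\<lambda>S. (S \<union> greedy S, greedy S)"]; intro ballI subsetI)
    fix z assume "z \<in> (SIGMA B:{B. nbc_basis n R B}. Pow (Act B))"
    then obtain B A where z: "z = (B, A)" "nbc_basis n R B" "A \<subseteq> Act B"
      by auto
    then have "greedy (B - A) = A"
      using greedy_remove_active[of B A] by (simp add: nbc_basis_def Act_def)
    moreover have "A \<subseteq> B"
      using z(3) by (auto simp: Act_def)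
    ultimately show "(\<lambda>S. (S \<union> greedy S, greedy S)) ((\<lambda>(B, A). B - A) z) = z"
      using z(1) by auto
  next
    fix S
    show "(\<lambda>(B, A). B - A) (S \<union> greedy S, greedy S) = S"
      using greedy_disjoint[of S] by auto
  next
    fix S assume "S \<in> (\<lambda>(B, A). B - A) ` (SIGMA B:{B. nbc_basis n R B}. Pow (Act B))"
    then show "S \<in> {S. nbc_set n R S}"
      using nbc_set_subset by (auto simp: nbc_basis_def)
  next
    fix z assume "z \<in> (\<lambda>S. (S \<union> greedy S, greedy S)) ` {S. nbc_set n R S}"
    then show "z \<in> (SIGMA B:{B. nbc_basis n R B}. Pow (Act B))"
      using nbc_basis_greedy greedy_active by (auto simp: Act_def)
  qed
  then have "(\<Sum>S | nbc_set n R S. t ^ (n - 1 - card S)) =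
      (\<Sum>(B, A)\<in>(SIGMA B:{B. nbc_basis n R B}. Pow (Act B)). t ^ (n - 1 - card (B - A)))"
    by (simp add: sum.reindex_bij_betw[symmetric] case_prod_unfold)
  also have "\<dots> = (\<Sum>B | nbc_basis n R B. \<Sum>A\<in>Pow (Act B). t ^ (n - 1 - card (B - A)))"
    using fin finA by (intro sum.Sigma[symmetric]) auto
  also have "\<dots> = (\<Sum>B | nbc_basis n R B. (t + 1) ^ activity n R B)"
  proof (intro sum.cong refl)
    fix B assume "B \<in> {B. nbc_basis n R B}"
    then have B: "nbc_basis n R B"
      by simp
    have "n - 1 - card (B - A) = card A" if "A \<in> Pow (Act B)" for A
    proof -
      have "A \<subseteq> B" "card B = n - 1"
        using that B card_spanning_tree[OF _ n_ge] by (auto simp: Act_def nbc_basis_def)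
      then show ?thesis
        using finB[OF B] card_mono[of B A] by (simp add: card_Diff_subset finite_subset)
    qed
    then have "(\<Sum>A\<in>Pow (Act B). t ^ (n - 1 - card (B - A))) = (\<Sum>A\<in>Pow (Act B). t ^ card A)"
      by simp
    also have "\<dots> = (t + 1) ^ card (Act B)"
      using sum_Pow_power[OF finA[OF B], of t 1] by simp
    finally show "(\<Sum>A\<in>Pow (Act B). t ^ (n - 1 - card (B - A))) = (t + 1) ^ activity n R B"
      by (simp add: activity_def Act_def)
  qed
  finally show ?thesis ..
qed

lemma card_nbc_bases_by_activity:
  assumes "k \<le> n - 1"
  shows "card {B. nbc_basis n R B \<and> activity n R B = k} = (n - 1 choose k) * (n - 1) ^ (n - 1 - k)"
proof -
  have "finite {B. nbc_basis n R B}"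
    by (rule finite_subset[of _ "Pow (shi_edges n)"]) (auto simp: nbc_basis_def spanning_tree_def)
  then have "card {B \<in> {B. nbc_basis n R B}. activity n R B = k} = (n - 1 choose k) * (n - 1) ^ (n - 1 - k)"
  proof (rule card_statistic_eq_binomial[OF _ n_ge assms])
    fix q :: int assume "q > int n"
    then show "(\<Sum>B\<in>{B. nbc_basis n R B}. (1 - q) ^ activity n R B) = (int n - q) ^ (n - 1)"
      using sum_nbc_bases_activity[of "- q"] sum_nbc_sets_power by simp
  qed
  then show ?thesis
    by simp
qed

end

section \<open>From an arbitrary linear order to ranks, and the comparison of the three
  counts\<close>

lemma linear_order_on_rank:
  assumes "finite A" "linear_order_on A R"
  obtains rank :: "'a \<Rightarrow> nat" where "inj_on rank A"
    and "\<And>e f. e \<in> A \<Longrightarrow> f \<in> A \<Longrightarrow> (e, f) \<in> R \<longleftrightarrow> rank e \<le> rank f"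
proof
  have refl: "\<And>e. e \<in> A \<Longrightarrow> (e, e) \<in> R" and trans: "trans R" and antisym: "antisym R"
    and total: "\<And>e f. e \<in> A \<Longrightarrow> f \<in> A \<Longrightarrow> e \<noteq> f \<Longrightarrow> (e, f) \<in> R \<or> (f, e) \<in> R"
    using assms(2) by (auto simp: order_on_defs refl_on_def total_on_def)
  \<comment> \<open>The number of elements up to and including \<open>e\<close>; going up strictly
    in the order enlarges this set strictly.\<close>
  define rank where "rank = (\<lambda>e. card {f \<in> A. (f, e) \<in> R})"
  have less: "rank e < rank f" if "e \<in> A" "f \<in> A" "(e, f) \<in> R" "e \<noteq> f" for e f
  proof -
    have "{g \<in> A. (g, e) \<in> R} \<subset> {g \<in> A. (g, f) \<in> R}"
      using that refl[of f] transD[OF trans] antisymD[OF antisym] by blast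
    then show ?thesis
      unfolding rank_def using assms(1) by (intro psubset_card_mono) auto
  qed
  show "(e, f) \<in> R \<longleftrightarrow> rank e \<le> rank f" if "e \<in> A" "f \<in> A" for e f
    using that less[of e f] less[of f e] total[of e f] refl[of e] by (cases "e = f") auto
  show "inj_on rank A"
    using less total by (metis inj_onI less_irrefl)
qed

theorem theorem5p2:
  fixes n k :: nat and R :: "gedge rel"
  assumes "n \<ge> 2" and "k \<le> n - 1"
    and "linear_order_on (shi_edges n) R"
  shows "card {B. nbc_basis n R B \<and> activity n R B = k}
           = card {(r, D). rooted_tree n r D \<and> card {i. (n, i) \<in> D} = k}
         \<and> card {(r, D). rooted_tree n r D \<and> card {i. (n, i) \<in> D} = k}
           = card {(r, D). rooted_tree n r D \<and> card {i. (i + 1, i) \<in> D} = k}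
         \<and> card {(r, D). rooted_tree n r D \<and> card {i. (i + 1, i) \<in> D} = k}
           = (n - 1 choose k) * (n - 1) ^ (n - 1 - k)"
proof -
  have n: "n \<ge> 1"
    using assms(1) by simp
  obtain rank :: "gedge \<Rightarrow> nat" where "inj_on rank (shi_edges n)"
    "\<And>e f. e \<in> shi_edges n \<Longrightarrow> f \<in> shi_edges n \<Longrightarrow> (e, f) \<in> R \<longleftrightarrow> rank e \<le> rank f"
    using linear_order_on_rank[OF finite_shi_edges assms(3)] by blast
  then interpret ranked_shi n R rank
    using n by unfold_locales
  show ?thesis
    using card_nbc_bases_by_activity[OF assms(2)] card_rooted_trees_by_children[OF n assms(2)]
      card_rooted_trees_by_descents[OF n assms(2)] by simp
qed

end
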